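(* Let $\gamma>0$ and let $F$ be a distribution function on $\mathbb{R}$ with $F\in\mathcal{S}_\gamma$ and $\hat\varphi_F<1$. Let $\{\xi_n\}_{n\ge1}$ be i.i.d. random variables with distribution function $F$, and let $S_n$, $M_n$, $M$ and the events $A_n^{a,x}$ be defined from $\{\xi_n\}$ as in the context. Then, for any fixed $t>0$, and for any positive function $h$ with $h(x)\le x/2$ for all $x>0$ and $\lim_{x\to\infty}h(x)=\infty$, $$\lim_{x\to\infty}\frac{1}{\overline{F}(x)}\mathbf{P}\biggl(M\in(x,x+t],\,\bigcup_{n\ge1}A_n^{h(x),x-h(x)}\biggr)=\lim_{x\to\infty}\frac{\mathbf{P}(M\in(x,x+t])}{\overline{F}(x)}=\frac{\mathbf{E} e^{\gamma M}}{1-\hat\varphi_F}\left(1-e^{-\gamma t}\right).$$ Moreover, for any $t_0>0$, the convergence (in both limits) is uniform in all $t\in[t_0,\infty]$, where for $t=\infty$ the interval $(x,x+t]$ is $(x,\infty)$ and $e^{-\gamma t}=0$.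
   Context: For a distribution function $F$ on $\mathbb{R}$, let $\overline{F}(x)=1-F(x)$, let $\varphi_F(\alpha)=\int_{-\infty}^\infty e^{\alpha x}\,dF(x)\in[0,\infty]$ for $\alpha\ge0$, and let $F^{*2}$ be the convolution of $F$ with itself. For $\gamma\ge0$, $F\in\mathcal{L}_\gamma$ if and only if $\overline{F}(x)>0$ for all $x$ and $\lim_{x\to\infty}\overline{F}(x-k)/\overline{F}(x)=e^{\gamma k}$ for every fixed $k\in\mathbb{R}$. For $F\in\mathcal{L}_\gamma$ write $\hat\varphi_F=\varphi_F(\gamma)$ (possibly infinite). $F\in\mathcal{S}_\gamma$ if and only if $F\in\mathcal{L}_\gamma$, $\hat\varphi_F<\infty$, and $\overline{F^{*2}}(x)\sim 2\hat\varphi_F\overline{F}(x)$ as $x\to\infty$, i.e. the ratio of the two sides tends to $1$. Random walk: $S_0=0$, $S_n=\sum_{i=1}^n\xi_i$ for $n\ge1$; $M_n=\max_{0\le i\le n}S_i$ for $n\ge0$; $M=\sup_{n\ge0}S_n$ (almost surely finite when $\gamma>0$ and $\hat\varphi_F<1$). For $x\ge a\ge0$ and $n\ge1$, $A_n^{a,x}=\{M_{n-1}\le a,\ S_n>x\}$; thus $A_n^{h(x),x-h(x)}=\{M_{n-1}\le h(x),\ S_n>x-h(x)\}$. *)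

theory Defs
  imports "HOL-Probability.Probability" "HOL-Library.Landau_Symbols"
begin

definition distribution_function :: "(real \<Rightarrow> real) \<Rightarrow> bool" where
  "distribution_function F \<longleftrightarrow>
     mono F \<and> (\<forall>a. continuous (at_right a) F) \<and>
     (F \<longlongrightarrow> 0) at_bot \<and> (F \<longlongrightarrow> 1) at_top"

definition tail :: "(real \<Rightarrow> real) \<Rightarrow> real \<Rightarrow> real" where
  "tail F x = 1 - F x"

(* For a distribution function F, interval_measure F is the Borel probability measure dF. *)

definition exp_moment :: "(real \<Rightarrow> real) \<Rightarrow> real \<Rightarrow> ennreal" where
  "exp_moment F \<alpha> = (\<integral>\<^sup>+ x. ennreal (exp (\<alpha> * x)) \<partial>interval_measure F)"

definition conv2 :: "(real \<Rightarrow> real) \<Rightarrow> real \<Rightarrow> real" where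
  "conv2 F = cdf (interval_measure F \<star> interval_measure F)"

definition class_L :: "real \<Rightarrow> (real \<Rightarrow> real) set" where
  "class_L \<gamma> = {F. distribution_function F \<and> (\<forall>x. tail F x > 0) \<and>
     (\<forall>k. ((\<lambda>x. tail F (x - k) / tail F x) \<longlongrightarrow> exp (\<gamma> * k)) at_top)}"

definition class_S :: "real \<Rightarrow> (real \<Rightarrow> real) set" where
  "class_S \<gamma> = {F. F \<in> class_L \<gamma> \<and> exp_moment F \<gamma> < \<infinity> \<and>
     tail (conv2 F) \<sim>[at_top] (\<lambda>x. 2 * enn2real (exp_moment F \<gamma>) * tail F x)}"

(* The increments are indexed from 1; the value \<xi> 0 is never used. *)

definition walk :: "(nat \<Rightarrow> 'a \<Rightarrow> real) \<Rightarrow> nat \<Rightarrow> 'a \<Rightarrow> real" where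
  "walk \<xi> n \<omega> = (\<Sum>i=1..n. \<xi> i \<omega>)"

definition walk_max :: "(nat \<Rightarrow> 'a \<Rightarrow> real) \<Rightarrow> nat \<Rightarrow> 'a \<Rightarrow> real" where
  "walk_max \<xi> n \<omega> = Max ((\<lambda>i. walk \<xi> i \<omega>) ` {0..n})"

(* Extended-real valued, because the walk may be unbounded on a null set. *)

definition walk_sup :: "(nat \<Rightarrow> 'a \<Rightarrow> real) \<Rightarrow> 'a \<Rightarrow> ereal" where
  "walk_sup \<xi> \<omega> = (SUP n. ereal (walk \<xi> n \<omega>))"

definition event_A :: "'a measure \<Rightarrow> (nat \<Rightarrow> 'a \<Rightarrow> real) \<Rightarrow> nat \<Rightarrow> real \<Rightarrow> real \<Rightarrow> 'a set" where
  "event_A P \<xi> n a x = {\<omega> \<in> space P. walk_max \<xi> (n - 1) \<omega> \<le> a \<and> walk \<xi> n \<omega> > x}"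

(* The real interval (x, x + t], read as (x, \<infinity>) for t = \<infinity>. *)

definition window :: "real \<Rightarrow> ereal \<Rightarrow> real set" where
  "window x t = (if t = \<infinity> then {x<..} else {x<..x + real_of_ereal t})"

definition event_M :: "'a measure \<Rightarrow> (nat \<Rightarrow> 'a \<Rightarrow> real) \<Rightarrow> real \<Rightarrow> ereal \<Rightarrow> 'a set" where
  "event_M P \<xi> x t = {\<omega> \<in> space P. walk_sup \<xi> \<omega> \<in> ereal ` window x t}"

(* exp (c * y) for c > 0 and extended real y > -\<infinity>. *)

definition exp_ext :: "real \<Rightarrow> ereal \<Rightarrow> ennreal" where
  "exp_ext c y = (if y = \<infinity> then \<infinity> else ennreal (exp (c * real_of_ereal y)))"

definition exp_moment_sup :: "'a measure \<Rightarrow> (nat \<Rightarrow> 'a \<Rightarrow> real) \<Rightarrow> real \<Rightarrow> ennreal" where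
  "exp_moment_sup P \<xi> \<gamma> = (\<integral>\<^sup>+ \<omega>. exp_ext \<gamma> (walk_sup \<xi> \<omega>) \<partial>P)"

(* exp (- c * t) for c > 0, equal to 0 at t = \<infinity>. *)

definition exp_minus_ext :: "real \<Rightarrow> ereal \<Rightarrow> real" where
  "exp_minus_ext c t = (if t = \<infinity> then 0 else exp (- c * real_of_ereal t))"

definition limit_value ::
  "'a measure \<Rightarrow> (nat \<Rightarrow> 'a \<Rightarrow> real) \<Rightarrow> (real \<Rightarrow> real) \<Rightarrow> real \<Rightarrow> ereal \<Rightarrow> real" where
  "limit_value P \<xi> F \<gamma> t =
     enn2real (exp_moment_sup P \<xi> \<gamma>) / (1 - enn2real (exp_moment F \<gamma>)) * (1 - exp_minus_ext \<gamma> t)"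

definition joint_prob ::
  "'a measure \<Rightarrow> (nat \<Rightarrow> 'a \<Rightarrow> real) \<Rightarrow> (real \<Rightarrow> real) \<Rightarrow> real \<Rightarrow> ereal \<Rightarrow> real" where
  "joint_prob P \<xi> h x t =
     measure P (event_M P \<xi> x t \<inter> (\<Union>n\<in>{1..}. event_A P \<xi> n (h x) (x - h x)))"

end

theory Submission
  imports Defs
begin

text \<open>
  The upper bound for \<open>P(M > x)\<close> comes from the Lindley recursion: \<open>M\<close> has the law of
  \<open>max 0 (\<xi> + M)\<close> with independent summands, and splitting \<open>\<xi> + M > x\<close> at \<open>\<xi> = x - A\<close> shows, by comparison
  with the convolution of \<open>F\<close> with itself, that an eventual bound \<open>P(M > x) \<le> a * tail F x\<close> improves to
  the constant \<open>\<phi> * a + E exp (\<gamma> M) + \<epsilon>\<close>, where \<open>\<phi> = exp_moment F \<gamma> < 1\<close>. Iterating, the limit superior of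
  \<open>P(M > x) / tail F x\<close> is at most \<open>E exp (\<gamma> M) / (1 - \<phi>)\<close>.

  The matching lower bound is proved directly for the joint event: for each \<open>j\<close>, Fatou's lemma applied to
  the walk jumping over \<open>x - h x\<close> at time \<open>j + 1\<close> from below \<open>h x\<close> contributes at least
  \<open>\<phi> ^ j * E exp (\<gamma> M)\<close>, and these events are disjoint in \<open>j\<close>. Hence both probabilities have the same
  asymptotics for \<open>t = \<infinity>\<close>, and their difference for \<open>t < \<infinity>\<close> is dominated by the difference for \<open>t = \<infinity>\<close>.
\<close>

section \<open>Tails of convolutions\<close>

text \<open>Fubini for real-valued probabilities. Both orders are needed: the two halves of the next
  splitting are integrated over different coordinates.\<close>

lemma (in pair_prob_space) measure_pair_eq_integral:
  assumes Q[measurable]: "Q \<in> sets (M1 \<Otimes>\<^sub>M M2)"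
  shows "measure (M1 \<Otimes>\<^sub>M M2) Q = (\<integral>x. measure M2 (Pair x -` Q) \<partial>M1)"
    and "measure (M1 \<Otimes>\<^sub>M M2) Q = (\<integral>y. measure M1 ((\<lambda>x. (x, y)) -` Q) \<partial>M2)"
proof -
  have int: "integrable (M1 \<Otimes>\<^sub>M M2) (indicator Q :: _ \<Rightarrow> real)"
    by (simp add: P.emeasure_eq_measure)
  have int': "integrable (M1 \<Otimes>\<^sub>M M2) (\<lambda>(x, y). indicator Q (x, y) :: real)"
    using int by simp
  have "(\<integral>y. indicator Q (x, y) \<partial>M2) = measure M2 (Pair x -` Q)" for x
  proof -
    have "(\<lambda>y. indicator Q (x, y) :: real) = indicator (Pair x -` Q)"
      by (auto simp: indicator_def)
    then show ?thesis
      using sets_Pair1[OF Q, of x] by (simp add: sets.sets_into_space Int_absorb2)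
  qed
  then show "measure (M1 \<Otimes>\<^sub>M M2) Q = (\<integral>x. measure M2 (Pair x -` Q) \<partial>M1)"
    using integral_fst'[OF int] sets.sets_into_space[OF Q] by (simp add: Int_absorb2)
  have "(\<integral>x. indicator Q (x, y) \<partial>M1) = measure M1 ((\<lambda>x. (x, y)) -` Q)" for y
  proof -
    have "(\<lambda>x. indicator Q (x, y) :: real) = indicator ((\<lambda>x. (x, y)) -` Q)"
      by (auto simp: indicator_def)
    then show ?thesis
      using sets_Pair2[OF Q, of y] by (simp add: sets.sets_into_space Int_absorb2)
  qed
  then show "measure (M1 \<Otimes>\<^sub>M M2) Q = (\<integral>y. measure M1 ((\<lambda>x. (x, y)) -` Q) \<partial>M2)"
    using integral_snd[OF int'] sets.sets_into_space[OF Q] by (simp add: Int_absorb2)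
qed

lemma (in real_distribution) measure_greaterThan: "measure M {x<..} = tail (cdf M) x"
proof -
  have "{x<..} = space M - {..x}" by auto
  then show ?thesis
    by (simp add: tail_def cdf_def prob_compl del: space_eq_univ)
qed

lemma real_distribution_pair:
  assumes "real_distribution M" "real_distribution N"
  shows "pair_prob_space M N"
  using assms unfolding pair_prob_space_def pair_sigma_finite_def real_distribution_def
  by (simp add: prob_space_imp_sigma_finite)

text \<open>The event is cut according to whether the first coordinate exceeds \<open>x - A\<close>.
  On the part where it does, a fixed second coordinate \<open>z\<close> leaves the two conditions
  \<open>fst p > x - A\<close> and \<open>fst p > x - z\<close>, which merge into
  \<open>fst p > x - min A z\<close>.\<close>

lemma measure_pair_sum_split:
  fixes x A :: real
  assumes M: "real_distribution M" and N: "real_distribution N"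
  shows "measure (M \<Otimes>\<^sub>M N) {p. fst p + snd p > x} =
    (\<integral>y. indicator {..x - A} y * measure N {x - y<..} \<partial>M) + (\<integral>z. measure M {x - min A z<..} \<partial>N)"
proof -
  interpret M: real_distribution M by fact
  interpret N: real_distribution N by fact
  interpret pair_prob_space M N by (rule real_distribution_pair) fact+
  have sp[simp]: "space (M \<Otimes>\<^sub>M N) = UNIV" by (simp add: space_pair_measure)
  let ?Q = "{p. fst p + snd p > x}" let ?B = "{p. fst p \<le> x - A}"
  have [measurable]: "fst \<in> borel_measurable (M \<Otimes>\<^sub>M N)" "snd \<in> borel_measurable (M \<Otimes>\<^sub>M N)"
    using measurable_fst[of M N] measurable_snd[of M N] by (simp_all cong: measurable_cong_sets)
  have "{p \<in> space (M \<Otimes>\<^sub>M N). fst p + snd p > x} \<in> sets (M \<Otimes>\<^sub>M N)" by measurable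
  then have Q: "?Q \<in> sets (M \<Otimes>\<^sub>M N)" by simp
  have "{p \<in> space (M \<Otimes>\<^sub>M N). fst p \<le> x - A} \<in> sets (M \<Otimes>\<^sub>M N)" by measurable
  then have B: "?B \<in> sets (M \<Otimes>\<^sub>M N)" by simp
  have "measure (M \<Otimes>\<^sub>M N) ?Q = measure (M \<Otimes>\<^sub>M N) (?Q \<inter> ?B) + measure (M \<Otimes>\<^sub>M N) (?Q - ?B)"
    using Q B by (subst P.finite_measure_Union[symmetric]) (auto intro!: arg_cong[where f="measure _"])
  also have "measure (M \<Otimes>\<^sub>M N) (?Q \<inter> ?B) = (\<integral>y. indicator {..x - A} y * measure N {x - y<..} \<partial>M)"
    using Q B by (subst measure_pair_eq_integral(1))
      (auto intro!: Bochner_Integration.integral_cong arg_cong[where f="measure _"] simp: indicator_def)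
  also have "measure (M \<Otimes>\<^sub>M N) (?Q - ?B) = (\<integral>z. measure M {x - min A z<..} \<partial>N)"
    using Q B by (subst measure_pair_eq_integral(2))
      (auto intro!: Bochner_Integration.integral_cong arg_cong[where f="measure _"] simp: min_def split: if_splits)
  finally show ?thesis .
qed

section \<open>Tail, exponential moment and convolution square of the step distribution\<close>

locale defective_S =
  fixes F :: "real \<Rightarrow> real" and \<gamma> :: real
  assumes gamma_pos: "\<gamma> > 0" and class_S: "F \<in> class_S \<gamma>" and moment_less_1: "exp_moment F \<gamma> < 1"
begin

abbreviation "\<nu> \<equiv> interval_measure F"
abbreviation "T \<equiv> tail F"
definition "\<phi> = enn2real (exp_moment F \<gamma>)"

lemma distribution_function_F: "distribution_function F"
  and tail_pos: "T x > 0"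
  and tail_nonneg: "T x \<ge> 0"
  and tail_neq_0[simp]: "T x \<noteq> 0"
  and tail_ratio: "((\<lambda>x. T (x - k) / T x) \<longlongrightarrow> exp (\<gamma> * k)) at_top"
  and conv2_equiv: "tail (conv2 F) \<sim>[at_top] (\<lambda>x. 2 * \<phi> * T x)"
  using class_S by (auto simp: class_S_def class_L_def \<phi>_def less_imp_le less_imp_neq[THEN not_sym])

lemma mono_F: "x \<le> y \<Longrightarrow> F x \<le> F y"
  using distribution_function_F by (auto simp: distribution_function_def mono_def)

sublocale nu: real_distribution \<nu>
  using distribution_function_F by (intro real_distribution_interval_measure)
    (auto simp: distribution_function_def mono_def)

lemma cdf_nu: "cdf \<nu> = F"
  using distribution_function_F by (intro cdf_interval_measure)
    (auto simp: distribution_function_def mono_def)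

lemma measure_nu_tail: "measure \<nu> {x<..} = T x"
  by (simp add: nu.measure_greaterThan cdf_nu)

lemma tail_antimono: "x \<le> y \<Longrightarrow> T y \<le> T x"
  using mono_F by (simp add: tail_def)

lemma tail_le_1: "T x \<le> 1"
  using measure_nu_tail[of x] nu.prob_le_1[of "{x<..}"] by simp

lemma borel_measurable_tail[measurable]: "T \<in> borel_measurable borel"
proof -
  have "F \<in> borel_measurable borel" by (rule borel_measurable_mono) (simp add: mono_def mono_F)
  then show ?thesis by (simp add: tail_def[abs_def])
qed

lemma conv2_tail: "tail (conv2 F) x = measure (\<nu> \<Otimes>\<^sub>M \<nu>) {p. fst p + snd p > x}"
proof -
  interpret pair_prob_space \<nu> \<nu>
    by (rule real_distribution_pair) (rule nu.real_distribution_axioms)+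
  have [measurable]: "(\<lambda>(x, y). x + y) \<in> borel_measurable (\<nu> \<Otimes>\<^sub>M \<nu>)"
    by measurable
  interpret D: real_distribution "distr (\<nu> \<Otimes>\<^sub>M \<nu>) borel (\<lambda>(x, y). x + y)"
    by (rule P.real_distribution_distr) measurable
  show ?thesis
    unfolding conv2_def convolution_def D.measure_greaterThan[symmetric]
    by (subst measure_distr) (auto simp: space_pair_measure intro!: arg_cong[where f="measure _"])
qed

lemma moment_eq: "exp_moment F \<gamma> = ennreal \<phi>"
  using moment_less_1 unfolding \<phi>_def by (metis ennreal_enn2real less_trans ennreal_one_less_top)

lemma phi_nonneg: "0 \<le> \<phi>" and phi_less_1: "\<phi> < 1"
  using moment_less_1 by (simp add: \<phi>_def) (use moment_less_1 in \<open>simp add: moment_eq\<close>)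

lemma integrable_exp: "integrable \<nu> (\<lambda>y. exp (\<gamma> * y))"
  and integral_exp: "(\<integral>y. exp (\<gamma> * y) \<partial>\<nu>) = \<phi>"
proof -
  have "(\<integral>\<^sup>+ y. ennreal (exp (\<gamma> * y)) \<partial>\<nu>) = ennreal \<phi>"
    using moment_eq by (simp add: exp_moment_def)
  then have "has_bochner_integral \<nu> (\<lambda>y. exp (\<gamma> * y)) \<phi>"
    by (intro has_bochner_integral_nn_integral) (auto simp: phi_nonneg)
  then show "integrable \<nu> (\<lambda>y. exp (\<gamma> * y))" "(\<integral>y. exp (\<gamma> * y) \<partial>\<nu>) = \<phi>"
    by (auto simp: has_bochner_integral_iff)
qed

lemma phi_pos: "0 < \<phi>"
proof -
  have "(\<integral>y. exp (\<gamma> * y) \<partial>\<nu>) > 0"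
    using nu.integral_less_AE_space[of "\<lambda>_. 0" "\<lambda>y. exp (\<gamma> * y)"] integrable_exp nu.emeasure_space_1
    by simp
  then show ?thesis by (simp add: integral_exp)
qed

lemma integrable_tail_min:
  assumes "real_distribution N"
  shows "integrable N (\<lambda>z. T (x - min A z))"
proof -
  interpret real_distribution N by fact
  show ?thesis
  proof (rule integrable_const_bound[where B=1])
    show "AE z in N. norm (T (x - min A z)) \<le> 1"
      by (simp add: tail_le_1 tail_nonneg)
    show "(\<lambda>z. T (x - min A z)) \<in> borel_measurable N"
      by (rule measurable_finite_borel) measurable
  qed
qed

text \<open>Splitting at \<open>\<xi> \<le> x - A\<close>: on this event the bound on the tail of \<open>N\<close> applies, and the resulting
  integral is the corresponding part of the convolution tail of \<open>F\<close> with itself.\<close>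

lemma sum_tail_le:
  assumes N: "real_distribution N" and K: "\<And>z. z \<ge> A \<Longrightarrow> measure N {z<..} \<le> K * T z"
  shows "measure (\<nu> \<Otimes>\<^sub>M N) {p. fst p + snd p > x} \<le>
    K * (tail (conv2 F) x - (\<integral>z. T (x - min A z) \<partial>\<nu>)) + (\<integral>z. T (x - min A z) \<partial>N)"
proof -
  interpret N: real_distribution N by fact
  have meas: "(\<lambda>y. measure N {x - y<..}) \<in> borel_measurable borel"
  proof (rule borel_measurable_mono)
    show "mono (\<lambda>y. measure N {x - y<..})"
      by (auto simp: mono_def intro!: N.finite_measure_mono)
  qed
  have bd: "norm (indicator {..x - A} y * measure N {x - y<..}) \<le> 1" for y
    by (auto simp: indicator_def)
  have "(\<integral>y. indicator {..x - A} y * measure N {x - y<..} \<partial>\<nu>) \<le>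
      (\<integral>y. K * (indicator {..x - A} y * T (x - y)) \<partial>\<nu>)"
  proof (rule integral_mono)
    show "integrable \<nu> (\<lambda>y. indicator {..x - A} y * measure N {x - y<..})"
      using meas bd by (intro nu.integrable_const_bound[where B=1]) auto
    have "norm (indicator {..x - A} y * T (x - y)) \<le> 1" for y
      using tail_le_1[of "x - y"] tail_pos[of "x - y"] by (auto simp: indicator_def)
    then show "integrable \<nu> (\<lambda>y. K * (indicator {..x - A} y * T (x - y)))"
      by (intro integrable_mult_right nu.integrable_const_bound[where B=1]) auto
  qed (auto simp: indicator_def K)
  also have "\<dots> = K * (\<integral>y. indicator {..x - A} y * T (x - y) \<partial>\<nu>)" by simp
  also have "(\<integral>y. indicator {..x - A} y * T (x - y) \<partial>\<nu>) = tail (conv2 F) x - (\<integral>z. T (x - min A z) \<partial>\<nu>)"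
    using measure_pair_sum_split[OF nu.real_distribution_axioms nu.real_distribution_axioms, of x A]
    by (simp add: conv2_tail measure_nu_tail)
  finally show ?thesis
    using measure_pair_sum_split[OF nu.real_distribution_axioms N, of x A] by (simp add: measure_nu_tail)
qed

text \<open>Truncating at \<open>A\<close> bounds the ratio by \<open>T (x - A) / T x\<close>, which
  is eventually below a constant. Dominated convergence then works for every law \<open>N\<close>,
  whatever its exponential moments.\<close>

lemma tendsto_integral_tail_min:
  assumes N: "real_distribution N"
  shows "((\<lambda>x. (\<integral>z. T (x - min A z) \<partial>N) / T x) \<longlongrightarrow> (\<integral>z. exp (\<gamma> * min A z) \<partial>N)) at_top"
proof -
  interpret N: real_distribution N by fact
  have "((\<lambda>x. \<integral>z. T (x - min A z) / T x \<partial>N) \<longlongrightarrow> (\<integral>z. exp (\<gamma> * min A z) \<partial>N)) at_top"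
  proof (rule integral_dominated_convergence_at_top[where w="\<lambda>_. exp (\<gamma> * A) + 1"])
    have "\<forall>\<^sub>F x in at_top. T (x - A) / T x < exp (\<gamma> * A) + 1"
      by (rule order_tendstoD(2)[OF tail_ratio]) simp
    then show "\<forall>\<^sub>F x in at_top. AE z in N. norm (T (x - min A z) / T x) \<le> exp (\<gamma> * A) + 1"
    proof eventually_elim
      case (elim x)
      have "norm (T (x - min A z) / T x) \<le> T (x - A) / T x" for z
        using tail_pos[of x] tail_pos[of "x - min A z"] tail_antimono[of "x - A" "x - min A z"]
        by (simp add: divide_right_mono)
      then show ?case using elim by (meson AE_I2 less_imp_le order_trans)
    qed
  qed (auto intro!: N.measurable_finite_borel tail_ratio)
  then show ?thesis by simp
qed

text \<open>Removes the truncation: finiteness of the exponential moment makes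
  \<open>exp (\<gamma> * z)\<close> an integrable majorant.\<close>

lemma tendsto_integral_exp_min:
  "((\<lambda>A. \<integral>z. exp (\<gamma> * min A z) \<partial>\<nu>) \<longlongrightarrow> \<phi>) at_top"
  unfolding integral_exp[symmetric]
proof (rule integral_dominated_convergence_at_top[where w="\<lambda>z. exp (\<gamma> * z)"])
  show "AE z in \<nu>. ((\<lambda>A. exp (\<gamma> * min A z)) \<longlongrightarrow> exp (\<gamma> * z)) at_top"
  proof (rule AE_I2)
    fix z
    have "\<forall>\<^sub>F A in at_top. exp (\<gamma> * min A z) = exp (\<gamma> * z)"
      using eventually_ge_at_top[of z] by eventually_elim (simp add: min_def)
    then show "((\<lambda>A. exp (\<gamma> * min A z)) \<longlongrightarrow> exp (\<gamma> * z)) at_top"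
      by (rule tendsto_eventually)
  qed
qed (use gamma_pos integrable_exp in \<open>auto simp: min_def\<close>)

text \<open>The convolution tail is asymptotically \<open>2 * \<phi> * T x\<close>, and the
  truncated integral already accounts for nearly \<open>\<phi> * T x\<close> of it once
  \<open>A\<close> is large. This is where the defining asymptotics of \<open>class_S\<close>
  enters.\<close>

lemma conv2_remainder_le:
  assumes "\<epsilon> > 0"
  shows "\<forall>\<^sub>F A in at_top. \<forall>\<^sub>F x in at_top. tail (conv2 F) x - (\<integral>z. T (x - min A z) \<partial>\<nu>) \<le> (\<phi> + \<epsilon>) * T x"
proof -
  have "((\<lambda>x. tail (conv2 F) x / (2 * \<phi> * T x)) \<longlongrightarrow> 1) at_top"
    using conv2_equiv tail_pos phi_pos by (intro asymp_equivD_strong) (auto simp: less_imp_neq[symmetric])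
  then have "((\<lambda>x. 2 * \<phi> * (tail (conv2 F) x / (2 * \<phi> * T x))) \<longlongrightarrow> 2 * \<phi> * 1) at_top"
    by (rule tendsto_mult_left)
  then have conv: "((\<lambda>x. tail (conv2 F) x / T x) \<longlongrightarrow> 2 * \<phi>) at_top"
    using phi_pos by simp
  have "\<forall>\<^sub>F A in at_top. (\<integral>z. exp (\<gamma> * min A z) \<partial>\<nu>) > \<phi> - \<epsilon>"
    using assms by (intro order_tendstoD(1)[OF tendsto_integral_exp_min]) simp
  then show ?thesis
  proof eventually_elim
    case (elim A)
    have "\<forall>\<^sub>F x in at_top. tail (conv2 F) x / T x - (\<integral>z. T (x - min A z) \<partial>\<nu>) / T x < \<phi> + \<epsilon>"
      by (rule order_tendstoD(2)[OF tendsto_diff[OF conv tendsto_integral_tail_min[OF nu.real_distribution_axioms]]])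
        (use elim in simp)
    then show ?case
      by eventually_elim (use tail_pos in \<open>simp add: field_simps less_imp_le\<close>)
  qed
qed

section \<open>Lindley recursion for the laws of the running maxima\<close>

primrec max_law :: "nat \<Rightarrow> real measure" where
  "max_law 0 = return borel 0"
| "max_law (Suc n) = distr (\<nu> \<Otimes>\<^sub>M max_law n) borel (\<lambda>p. max 0 (fst p + snd p))"

lemma real_distribution_max_law: "real_distribution (max_law n)"
proof (induction n)
  case 0
  then show ?case
    by (simp add: real_distribution_def real_distribution_axioms_def prob_space_return)
next
  case (Suc n)
  then interpret N: real_distribution "max_law n" .
  interpret pair_prob_space \<nu> "max_law n"
    by (rule real_distribution_pair) (rule nu.real_distribution_axioms Suc)+
  show ?case by simp
qed

lemma max_law_Suc_tail:
  assumes "x \<ge> 0"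
  shows "measure (max_law (Suc n)) {x<..} = measure (\<nu> \<Otimes>\<^sub>M max_law n) {p. fst p + snd p > x}"
proof -
  interpret N: real_distribution "max_law n" by (rule real_distribution_max_law)
  show ?thesis using assms
    by (auto simp: measure_distr space_pair_measure intro!: arg_cong[where f="measure _"])
qed

text \<open>The constant is preserved by the recursion because the first summand of \<open>sum_tail_le\<close>
  contributes a factor below \<open>1\<close>.\<close>

lemma max_law_tail_bound:
  obtains K where "\<And>n x. measure (max_law n) {x<..} \<le> K * T x" "K \<ge> 0"
proof -
  \<comment> \<open>The midpoint of \<open>\<phi>\<close> and \<open>1\<close>: above
    \<open>\<phi>\<close>, so that \<open>conv2_remainder_le\<close> applies, and below
    \<open>1\<close>, so that the recursion contracts.\<close>
  define r where "r = \<phi> + (1 - \<phi>) / 2"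
  have r: "r < 1" "r > 0" using phi_less_1 phi_pos by (simp_all add: r_def field_simps)
  have "\<forall>\<^sub>F A in at_top. \<forall>\<^sub>F x in at_top. tail (conv2 F) x - (\<integral>z. T (x - min A z) \<partial>\<nu>) \<le> r * T x"
    using conv2_remainder_le[of "(1 - \<phi>) / 2"] phi_less_1 by (simp add: r_def)
  then obtain A where A: "\<forall>\<^sub>F x in at_top. tail (conv2 F) x - (\<integral>z. T (x - min A z) \<partial>\<nu>) \<le> r * T x"
    by (auto dest: eventually_happens)
  define C where "C = exp (\<gamma> * A) + 1"
  have "\<forall>\<^sub>F x in at_top. T (x - A) / T x < C"
    unfolding C_def by (rule order_tendstoD(2)[OF tail_ratio]) simp
  with A have "\<forall>\<^sub>F x in at_top. tail (conv2 F) x - (\<integral>z. T (x - min A z) \<partial>\<nu>) \<le> r * T x \<and> T (x - A) \<le> C * T x \<and> x \<ge> 0"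
    using eventually_ge_at_top[of 0]
    by eventually_elim (use tail_pos in \<open>simp add: field_simps less_imp_le\<close>)
  then obtain x0 where x0: "\<And>x. x \<ge> x0 \<Longrightarrow> tail (conv2 F) x - (\<integral>z. T (x - min A z) \<partial>\<nu>) \<le> r * T x"
     "\<And>x. x \<ge> x0 \<Longrightarrow> T (x - A) \<le> C * T x" "x0 \<ge> 0"
    unfolding eventually_at_top_linorder by blast
  \<comment> \<open>The first entry makes the bound trivial below \<open>x0\<close>, where
    \<open>T x\<close> is at least \<open>T x0\<close>. The second gives
    \<open>r * K + C \<le> K\<close>, which closes the induction above \<open>x0\<close> with the
    same \<open>K\<close> for every \<open>n\<close>.\<close>
  define K where "K = max (1 / T x0) (C / (1 - r))"
  have C0: "C > 0" by (simp add: C_def add_pos_pos)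
  have K0: "K \<ge> 0" using C0 r by (simp add: K_def le_max_iff_disj)
  have small: "measure (max_law n) {x<..} \<le> K * T x" if "x < x0" for n x
  proof -
    interpret N: real_distribution "max_law n" by (rule real_distribution_max_law)
    have "measure (max_law n) {x<..} \<le> 1 / T x0 * T x0" using tail_pos[of x0] by simp
    also have "\<dots> \<le> K * T x"
      using that tail_pos[of x0] tail_antimono[of x x0] by (intro mult_mono) (auto simp: K_def le_max_iff_disj)
    finally show ?thesis .
  qed
  have "measure (max_law n) {x<..} \<le> K * T x" for n x
  proof (induction n arbitrary: x)
    case 0
    then show ?case
      using small[of x 0] x0(3) tail_pos[of x] K0 by (cases "x < x0") (auto simp: measure_return)
  next
    case (Suc n)
    interpret N: real_distribution "max_law n" by (rule real_distribution_max_law)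
    show ?case
    proof (cases "x < x0")
      case False
      have "measure (max_law (Suc n)) {x<..} \<le>
        K * (tail (conv2 F) x - (\<integral>z. T (x - min A z) \<partial>\<nu>)) + (\<integral>z. T (x - min A z) \<partial>max_law n)"
        using False x0(3) by (subst max_law_Suc_tail) (auto intro!: sum_tail_le real_distribution_max_law Suc)
      also have "(\<integral>z. T (x - min A z) \<partial>max_law n) \<le> (\<integral>z. T (x - A) \<partial>max_law n)"
        by (rule integral_mono[OF integrable_tail_min[OF real_distribution_max_law]]) (auto intro!: tail_antimono)
      also have "(\<integral>z. T (x - A) \<partial>max_law n) = T (x - A)"
        using N.prob_space by simp
      also have "\<dots> \<le> C * T x" using False by (intro x0(2)) simp
      also have "C \<le> K * (1 - r)"
        using r by (simp add: K_def pos_divide_le_eq[symmetric])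
      also have "K * (tail (conv2 F) x - (\<integral>z. T (x - min A z) \<partial>\<nu>)) \<le> K * (r * T x)"
        using False K0 by (intro mult_left_mono x0(1)) auto
      finally show ?thesis using tail_pos[of x] by (simp add: algebra_simps)
    qed (rule small)
  qed
  with K0 that show ?thesis by blast
qed

text \<open>From \<open>exp (max 0 s) \<le> 1 + exp s\<close> and independence, each step maps a
  bound \<open>b\<close> to \<open>1 + \<phi> * b\<close>, whose fixed point is
  \<open>1 / (1 - \<phi>)\<close>. Uniformity in \<open>n\<close> later yields a finite exponential
  moment of the supremum.\<close>

lemma max_law_moment:
  "(\<integral>\<^sup>+ y. ennreal (exp (\<gamma> * y)) \<partial>max_law n) \<le> ennreal (1 / (1 - \<phi>))"
proof (induction n)
  case 0
  then show ?case using phi_less_1 phi_nonneg by (simp add: nn_integral_return flip: ennreal_1)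
next
  case (Suc n)
  interpret N: real_distribution "max_law n" by (rule real_distribution_max_law)
  interpret pair_prob_space \<nu> "max_law n"
    by (rule real_distribution_pair) (rule nu.real_distribution_axioms real_distribution_max_law)+
  have "(\<integral>\<^sup>+ y. ennreal (exp (\<gamma> * y)) \<partial>max_law (Suc n)) =
      (\<integral>\<^sup>+ p. ennreal (exp (\<gamma> * max 0 (fst p + snd p))) \<partial>(\<nu> \<Otimes>\<^sub>M max_law n))"
    by (simp add: nn_integral_distr)
  also have "\<dots> \<le> (\<integral>\<^sup>+ p. 1 + ennreal (exp (\<gamma> * fst p)) * ennreal (exp (\<gamma> * snd p)) \<partial>(\<nu> \<Otimes>\<^sub>M max_law n))"
  proof (rule nn_integral_mono)
    fix p :: "real \<times> real"
    have "exp (\<gamma> * max 0 (fst p + snd p)) \<le> 1 + exp (\<gamma> * fst p) * exp (\<gamma> * snd p)"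
      by (auto simp: max_def distrib_left exp_add)
    then have "ennreal (exp (\<gamma> * max 0 (fst p + snd p))) \<le> ennreal (1 + exp (\<gamma> * fst p) * exp (\<gamma> * snd p))"
      by (rule ennreal_leI)
    then show "ennreal (exp (\<gamma> * max 0 (fst p + snd p))) \<le> 1 + ennreal (exp (\<gamma> * fst p)) * ennreal (exp (\<gamma> * snd p))"
      by (simp add: ennreal_mult)
  qed
  also have "\<dots> = 1 + (\<integral>\<^sup>+ p. ennreal (exp (\<gamma> * fst p)) * ennreal (exp (\<gamma> * snd p)) \<partial>(\<nu> \<Otimes>\<^sub>M max_law n))"
    by (subst nn_integral_add) (auto simp: P.emeasure_space_1)
  also have "(\<integral>\<^sup>+ p. ennreal (exp (\<gamma> * fst p)) * ennreal (exp (\<gamma> * snd p)) \<partial>(\<nu> \<Otimes>\<^sub>M max_law n)) =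
      (\<integral>\<^sup>+ x. ennreal (exp (\<gamma> * x)) \<partial>\<nu>) * (\<integral>\<^sup>+ y. ennreal (exp (\<gamma> * y)) \<partial>max_law n)"
    by (subst N.nn_integral_fst[symmetric]) (auto simp: nn_integral_cmult nn_integral_multc)
  also have "(\<integral>\<^sup>+ x. ennreal (exp (\<gamma> * x)) \<partial>\<nu>) = ennreal \<phi>"
    using moment_eq by (simp add: exp_moment_def)
  also have "1 + ennreal \<phi> * (\<integral>\<^sup>+ y. ennreal (exp (\<gamma> * y)) \<partial>max_law n) \<le> 1 + ennreal \<phi> * ennreal (1 / (1 - \<phi>))"
    by (intro add_left_mono mult_left_mono Suc) simp
  also have "\<dots> = ennreal (1 + \<phi> * (1 / (1 - \<phi>)))"
    using phi_less_1 phi_nonneg by (simp add: ennreal_mult del: times_divide_eq_right)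
  also have "1 + \<phi> * (1 / (1 - \<phi>)) = 1 / (1 - \<phi>)"
    using phi_less_1 by (simp add: field_simps)
  finally show ?case .
qed

text \<open>Polya's argument: for fixed \<open>x\<close> the ratio is antimonotone in
  \<open>t\<close>, and the limit is continuous and decreases from \<open>1\<close> to
  \<open>0\<close>. Convergence at finitely many grid points therefore controls all \<open>t\<close>
  between them.\<close>

lemma tail_ratio_uniform:
  assumes "\<epsilon> > 0"
  shows "\<forall>\<^sub>F x in at_top. \<forall>t\<ge>0. \<bar>T (x + t) / T x - exp (- \<gamma> * t)\<bar> < \<epsilon>"
proof -
  obtain n :: nat where n: "n > 0" "1 / real n < \<epsilon> / 2"
    using assms by (metis half_gt_zero nat_approx_posE zero_less_Suc)
  \<comment> \<open>Grid points at which the limit function takes equally spaced values. The value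
    \<open>0\<close>, for \<open>i = n\<close>, would belong to an infinite \<open>t\<close>, so
    only \<open>i < n\<close> is used.\<close>
  define g where "g i = - ln (1 - real i / real n) / \<gamma>" for i
  have g: "exp (- \<gamma> * g i) = 1 - real i / real n" if "i < n" for i
    using that gamma_pos by (simp add: g_def)
  have "\<forall>\<^sub>F x in at_top. \<bar>T (x + g i) / T x - (1 - real i / real n)\<bar> < \<epsilon> / 2" if "i < n" for i
    using tendstoD[OF tail_ratio[of "- g i"], of "\<epsilon> / 2"] assms g[OF that] by (simp add: dist_real_def)
  then have "\<forall>\<^sub>F x in at_top. \<forall>i\<in>{..<n}. \<bar>T (x + g i) / T x - (1 - real i / real n)\<bar> < \<epsilon> / 2"
    by (intro eventually_ball_finite) auto
  then show ?thesis
  proof eventually_elim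
    case (elim x)
    have grid: "T (x + g i) / T x < 1 - real i / real n + \<epsilon> / 2"
      "1 - real i / real n - \<epsilon> / 2 < T (x + g i) / T x" if "i < n" for i
      using elim[unfolded Ball_def, rule_format, of i] that unfolding abs_less_iff lessThan_iff by linarith+
    show ?case
    proof (intro allI impI)
      fix t :: real assume "t \<ge> 0"
      define s where "s = exp (- \<gamma> * t)"
      have s: "0 < s" "s \<le> 1" using \<open>t \<ge> 0\<close> gamma_pos by (auto simp: s_def)
      \<comment> \<open>The index of the grid cell containing \<open>t\<close>: \<open>g i\<close>
        lies to its left and, if it exists, \<open>g (Suc i)\<close> to its right.\<close>
      define i where "i = nat \<lfloor>(1 - s) * real n\<rfloor>"
      have i1: "real i \<le> (1 - s) * real n" and i2: "(1 - s) * real n < real i + 1"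
        using s by (auto simp: i_def)
      have i1': "real i / real n \<le> 1 - s" and i2': "1 - s < real i / real n + 1 / real n"
        using i1 i2 n(1)
        by (simp_all add: pos_divide_le_eq pos_less_divide_eq add_divide_distrib[symmetric])
      have Suc_i: "real (Suc i) / real n = real i / real n + 1 / real n"
        by (simp add: add_divide_distrib)
      have "(1 - s) * real n < 1 * real n" using s n(1) by (intro mult_strict_right_mono) auto
      with i1 have "real i < real n" by linarith
      then have "i < n" by simp
      have gt: "g j \<le> t \<longleftrightarrow> s \<le> 1 - real j / real n" if "j < n" for j
      proof -
        have "g j \<le> t \<longleftrightarrow> exp (- \<gamma> * t) \<le> exp (- \<gamma> * g j)" using gamma_pos by simp
        then show ?thesis unfolding g[OF that] s_def .
      qed
      have up: "T (x + t) / T x < s + \<epsilon>"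
      proof -
        have "g i \<le> t" using gt[OF \<open>i < n\<close>] i1' by linarith
        then have "T (x + t) / T x \<le> T (x + g i) / T x"
          using tail_pos[of x] by (intro divide_right_mono tail_antimono) auto
        also have "\<dots> < 1 - real i / real n + \<epsilon> / 2" by (rule grid(1)) fact
        also have "1 - real i / real n < s + 1 / real n" using i2' by linarith
        finally show ?thesis using n(2) by simp
      qed
      have lo: "s - \<epsilon> < T (x + t) / T x"
      proof (cases "Suc i < n")
        case True
        have "1 - real (Suc i) / real n < s"
          using i2' Suc_i by linarith
        then have "t \<le> g (Suc i)"
          using gt[OF True] by linarith
        then have "T (x + g (Suc i)) / T x \<le> T (x + t) / T x"
          using tail_pos[of x] by (intro divide_right_mono tail_antimono) auto
        moreover have "1 - real (Suc i) / real n - \<epsilon> / 2 < T (x + g (Suc i)) / T x"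
          by (rule grid(2)) fact
        moreover have "s - 1 / real n \<le> 1 - real (Suc i) / real n" using i1' Suc_i by linarith
        ultimately show ?thesis using n(2) assms by linarith
      next
        \<comment> \<open>The last cell is unbounded. There \<open>s\<close> is at most
          \<open>1 / n\<close>, so the lower bound is negative and positivity of the ratio
          suffices.\<close>
        case False
        then have "real i + 1 = real n" using \<open>i < n\<close> by linarith
        then have "s * real n \<le> 1" using i1 by (simp add: algebra_simps)
        then have "s \<le> 1 / real n" using n(1) by (simp add: field_simps)
        then have "s - \<epsilon> < 0" using n(2) assms by linarith
        also have "0 < T (x + t) / T x" using tail_pos by simp
        finally show ?thesis .
      qed
      show "\<bar>T (x + t) / T x - exp (- \<gamma> * t)\<bar> < \<epsilon>"
        unfolding s_def[symmetric] abs_less_iff using up lo by linarith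
    qed
  qed
qed

end

section \<open>The running maximum of the walk\<close>

text \<open>The library's \<open>indep_var\<close> forces both variables to have the same type.\<close>

definition (in prob_space) indep_pair :: "'b measure \<Rightarrow> ('a \<Rightarrow> 'b) \<Rightarrow> 'c measure \<Rightarrow> ('a \<Rightarrow> 'c) \<Rightarrow> bool" where
  "indep_pair S X N V \<longleftrightarrow> X \<in> M \<rightarrow>\<^sub>M S \<and> V \<in> M \<rightarrow>\<^sub>M N \<and>
     distr M S X \<Otimes>\<^sub>M distr M N V = distr M (S \<Otimes>\<^sub>M N) (\<lambda>\<omega>. (X \<omega>, V \<omega>))"

text \<open>Conditioning on \<open>V\<close>: only \<open>X\<close> is replaced by its law, while
  \<open>V\<close> stays on the sample space. Later \<open>X\<close> is one step and
  \<open>V\<close> collects functionals of the other steps.\<close>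

lemma (in prob_space) indep_pair_nn_integral:
  assumes ind: "indep_pair S X N V" and g: "g \<in> borel_measurable (S \<Otimes>\<^sub>M N)"
  shows "(\<integral>\<^sup>+ \<omega>. g (X \<omega>, V \<omega>) \<partial>M) = (\<integral>\<^sup>+ \<omega>. (\<integral>\<^sup>+ x. g (x, V \<omega>) \<partial>distr M S X) \<partial>M)"
proof -
  have X[measurable]: "X \<in> M \<rightarrow>\<^sub>M S" and V[measurable]: "V \<in> M \<rightarrow>\<^sub>M N"
    and eq: "distr M S X \<Otimes>\<^sub>M distr M N V = distr M (S \<Otimes>\<^sub>M N) (\<lambda>\<omega>. (X \<omega>, V \<omega>))"
    using ind by (auto simp: indep_pair_def)
  interpret X: prob_space "distr M S X" by (rule prob_space_distr) fact
  interpret V: prob_space "distr M N V" by (rule prob_space_distr) fact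
  interpret pair_prob_space "distr M S X" "distr M N V" ..
  have g': "g \<in> borel_measurable (distr M S X \<Otimes>\<^sub>M distr M N V)"
    using g by simp
  have "(\<integral>\<^sup>+ \<omega>. g (X \<omega>, V \<omega>) \<partial>M) = integral\<^sup>N (distr M S X \<Otimes>\<^sub>M distr M N V) g"
    unfolding eq using g by (simp add: nn_integral_distr)
  also have "\<dots> = (\<integral>\<^sup>+ v. (\<integral>\<^sup>+ x. g (x, v) \<partial>distr M S X) \<partial>distr M N V)"
    by (rule nn_integral_snd[symmetric]) (simp add: g')
  also have "\<dots> = (\<integral>\<^sup>+ \<omega>. (\<integral>\<^sup>+ x. g (x, V \<omega>) \<partial>distr M S X) \<partial>M)"
    by (rule nn_integral_distr) (use g in \<open>auto intro!: X.borel_measurable_nn_integral measurable_pair_swap' simp: measurable_split_conv\<close>)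
  finally show ?thesis .
qed

text \<open>Reduces a limit along the reals to sequences, along which Fatou's lemma can be
  applied.\<close>

lemma eventually_at_top_sequentiallyI:
  fixes Q :: "real \<Rightarrow> bool"
  assumes "\<And>X :: nat \<Rightarrow> real. filterlim X at_top sequentially \<Longrightarrow> \<forall>\<^sub>F k in sequentially. Q (X k)"
  shows "eventually Q at_top"
proof (rule ccontr)
  assume "\<not> eventually Q at_top"
  then have "\<exists>x\<ge>real k. \<not> Q x" for k
    by (auto simp: eventually_at_top_linorder)
  then obtain X where X: "\<And>k. X k \<ge> real k" "\<And>k. \<not> Q (X k)" by metis
  have "filterlim X at_top sequentially"
    by (rule filterlim_at_top_mono[OF filterlim_real_sequentially]) (simp add: X)
  then have "\<forall>\<^sub>F k in sequentially. Q (X k)" by (rule assms)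
  with X(2) show False by simp
qed

section \<open>Pathwise identities for the walk, its running maximum and its supremum\<close>

lemma walk_0[simp]: "walk X 0 \<omega> = 0"
  by (simp add: walk_def)

lemma walk_Suc: "walk X (Suc n) \<omega> = walk X n \<omega> + X (Suc n) \<omega>"
  by (simp add: walk_def)

lemma walk_add: "walk X (m + n) \<omega> = walk X m \<omega> + walk (\<lambda>i. X (i + m)) n \<omega>"
  by (induction n) (simp_all add: walk_Suc add_ac)

lemma walk_Suc_shift: "walk X (Suc n) \<omega> = X 1 \<omega> + walk (\<lambda>i. X (Suc i)) n \<omega>"
  using walk_add[of X 1 n \<omega>] by (simp add: walk_def)

text \<open>Processes and sample points may both differ, so that a functional of
  \<open>\<xi>\<close> can be read as the same functional of the coordinate projections on a product
  space.\<close>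

lemma walk_cong: "(\<And>i. i \<in> {1..n} \<Longrightarrow> X i \<omega> = Y i \<omega>') \<Longrightarrow> walk X n \<omega> = walk Y n \<omega>'"
  by (simp add: walk_def)

lemma walk_max_cong: "(\<And>i. i \<in> {1..n} \<Longrightarrow> X i \<omega> = Y i \<omega>') \<Longrightarrow> walk_max X n \<omega> = walk_max Y n \<omega>'"
  unfolding walk_max_def by (intro arg_cong[where f=Max] image_cong refl walk_cong) auto

lemma walk_le_walk_max: "i \<le> n \<Longrightarrow> walk X i \<omega> \<le> walk_max X n \<omega>"
  unfolding walk_max_def by (rule Max_ge) auto

lemma walk_max_attained: "\<exists>i\<le>n. walk_max X n \<omega> = walk X i \<omega>"
proof -
  have "walk_max X n \<omega> \<in> (\<lambda>i. walk X i \<omega>) ` {0..n}"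
    unfolding walk_max_def by (rule Max_in) auto
  then show ?thesis by auto
qed

lemma walk_max_0[simp]: "walk_max X 0 \<omega> = 0"
  by (simp add: walk_max_def)

lemma walk_max_mono: "m \<le> n \<Longrightarrow> walk_max X m \<omega> \<le> walk_max X n \<omega>"
  by (metis walk_max_attained walk_le_walk_max order_trans)

text \<open>The Lindley recursion path by path: index \<open>0\<close> contributes \<open>0\<close>,
  and every later position is the first step plus a position of the walk restarted after it.\<close>

lemma walk_max_Suc: "walk_max X (Suc n) \<omega> = max 0 (X 1 \<omega> + walk_max (\<lambda>i. X (Suc i)) n \<omega>)"
proof -
  have "{0..Suc n} = insert 0 (Suc ` {0..n})"
    by (metis atLeast0_atMost_Suc_eq_insert_0 atLeast0AtMost)
  then have "(\<lambda>i. walk X i \<omega>) ` {0..Suc n} = insert (walk X 0 \<omega>) ((\<lambda>i. walk X (Suc i) \<omega>) ` {0..n})"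
    by (simp only: image_insert image_image)
  also have "\<dots> = insert 0 ((\<lambda>i. walk (\<lambda>i. X (Suc i)) i \<omega> + X 1 \<omega>) ` {0..n})"
    by (simp add: walk_Suc_shift add.commute)
  finally have "(\<lambda>i. walk X i \<omega>) ` {0..Suc n} = insert 0 ((\<lambda>i. walk (\<lambda>i. X (Suc i)) i \<omega> + X 1 \<omega>) ` {0..n})" .
  then have "walk_max X (Suc n) \<omega> = max 0 (Max ((\<lambda>i. walk (\<lambda>i. X (Suc i)) i \<omega> + X 1 \<omega>) ` {0..n}))"
    by (simp add: walk_max_def)
  also have "Max ((\<lambda>i. walk (\<lambda>i. X (Suc i)) i \<omega> + X 1 \<omega>) ` {0..n}) = walk_max (\<lambda>i. X (Suc i)) n \<omega> + X 1 \<omega>"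
    unfolding walk_max_def by (rule Max_add_commute) auto
  finally show ?thesis by (simp add: add.commute)
qed

lemma measurable_walk:
  "(\<And>i. i \<in> {1..n} \<Longrightarrow> X i \<in> borel_measurable M) \<Longrightarrow> walk X n \<in> borel_measurable M"
  unfolding walk_def[abs_def] by (rule borel_measurable_sum)

lemma measurable_walk_max:
  "(\<And>i. i \<in> {1..n} \<Longrightarrow> X i \<in> borel_measurable M) \<Longrightarrow> walk_max X n \<in> borel_measurable M"
  unfolding walk_max_def[abs_def] by (intro borel_measurable_Max measurable_walk) auto

lemma walk_sup_eq_SUP_walk_max: "walk_sup X \<omega> = (SUP n. ereal (walk_max X n \<omega>))"
  unfolding walk_sup_def
proof (rule antisym; rule SUP_least)
  show "ereal (walk X n \<omega>) \<le> (SUP n. ereal (walk_max X n \<omega>))" for n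
    by (rule SUP_upper2[of n]) (simp_all add: walk_le_walk_max)
  show "ereal (walk_max X n \<omega>) \<le> (SUP n. ereal (walk X n \<omega>))" for n
    using walk_max_attained[of n X \<omega>] by (metis SUP_upper UNIV_I)
qed

lemma walk_max_tendsto_walk_sup: "(\<lambda>n. ereal (walk_max X n \<omega>)) \<longlonglongrightarrow> walk_sup X \<omega>"
  unfolding walk_sup_eq_SUP_walk_max by (rule LIMSEQ_SUP) (simp add: incseq_def walk_max_mono)

lemma walk_max_le_walk_sup: "ereal (walk_max X n \<omega>) \<le> walk_sup X \<omega>"
  unfolding walk_sup_eq_SUP_walk_max by (rule SUP_upper) simp

lemma walk_sup_nonneg: "0 \<le> walk_sup X \<omega>"
  using walk_max_le_walk_sup[of X 0 \<omega>] by (simp add: zero_ereal_def)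

lemma less_walk_sup_iff: "ereal x < walk_sup X \<omega> \<longleftrightarrow> (\<exists>n. x < walk_max X n \<omega>)"
  by (simp add: walk_sup_eq_SUP_walk_max less_SUP_iff)

text \<open>Continuity of the exponential along the increasing running maxima, including the value
  \<open>\<infinity>\<close>. It permits monotone convergence before the supremum is known to be
  almost surely finite.\<close>

lemma exp_ext_walk_sup:
  assumes "c > 0"
  shows "exp_ext c (walk_sup X \<omega>) = (SUP n. ennreal (exp (c * walk_max X n \<omega>)))"
proof -
  have "(\<lambda>n. ennreal (exp (c * walk_max X n \<omega>))) \<longlonglongrightarrow> exp_ext c (walk_sup X \<omega>)"
  proof (cases "walk_sup X \<omega>")
    case (real r)
    then have "(\<lambda>n. walk_max X n \<omega>) \<longlonglongrightarrow> r"
      using walk_max_tendsto_walk_sup[of X \<omega>] by simp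
    then show ?thesis
      using real by (auto simp: exp_ext_def intro!: tendsto_intros)
  next
    case PInf
    then have "filterlim (\<lambda>n. walk_max X n \<omega>) at_top sequentially"
      using walk_max_tendsto_walk_sup[of X \<omega>] by (simp add: tendsto_PInfty_eq_at_top)
    then have "filterlim (\<lambda>n. exp (c * walk_max X n \<omega>)) at_top sequentially"
      using assms by (intro filterlim_compose[OF exp_at_top] filterlim_tendsto_pos_mult_at_top[OF tendsto_const])
    then show ?thesis
      using PInf by (simp add: exp_ext_def ennreal_tendsto_top_eq_at_top)
  next
    case MInf
    then show ?thesis using walk_sup_nonneg[of X \<omega>] by simp
  qed
  moreover have "(\<lambda>n. ennreal (exp (c * walk_max X n \<omega>))) \<longlonglongrightarrow> (SUP n. ennreal (exp (c * walk_max X n \<omega>)))"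
    using assms by (intro LIMSEQ_SUP) (auto simp: incseq_def intro!: ennreal_leI walk_max_mono)
  ultimately show ?thesis by (rule LIMSEQ_unique)
qed

section \<open>Walks with i.i.d. steps: time shift and independence of one step from the
  others\<close>

locale iid_walk = prob_space P for P :: "'a measure" +
  fixes \<xi> :: "nat \<Rightarrow> 'a \<Rightarrow> real" and \<mu> :: "real measure"
  assumes indep: "indep_vars (\<lambda>_. borel) \<xi> {1..}"
    and distr_step: "n \<ge> 1 \<Longrightarrow> distr P borel (\<xi> n) = \<mu>"
begin

lemma measurable_step: "n \<ge> 1 \<Longrightarrow> \<xi> n \<in> borel_measurable P"
  using indep by (auto simp: indep_vars_def)

lemma measurable_walk_xi[measurable]: "walk \<xi> n \<in> borel_measurable P"
  by (rule measurable_walk) (simp add: measurable_step)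

lemma measurable_walk_max_xi[measurable]: "walk_max \<xi> n \<in> borel_measurable P"
  by (rule measurable_walk_max) (simp add: measurable_step)

lemma measurable_walk_sup_xi[measurable]: "walk_sup \<xi> \<in> borel_measurable P"
  unfolding walk_sup_def[abs_def] by measurable

lemma shift: "iid_walk P (\<lambda>i. \<xi> (i + k)) \<mu>"
proof
  \<comment> \<open>Grouping the indices into the singletons \<open>{j + k}\<close> reindexes the
    independent family.\<close>
  have "indep_vars (\<lambda>j. PiM {j + k} (\<lambda>_. borel)) (\<lambda>j \<omega>. restrict (\<lambda>i. \<xi> i \<omega>) {j + k}) {1..}"
    by (rule indep_vars_restrict[OF indep]) (auto simp: disjoint_family_on_def)
  then have "indep_vars (\<lambda>_. borel) (\<lambda>j \<omega>. (\<lambda>f. f (j + k)) (restrict (\<lambda>i. \<xi> i \<omega>) {j + k})) {1..}"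
    by (rule indep_vars_compose2) (rule measurable_component_singleton, simp)
  then show "indep_vars (\<lambda>_. borel) (\<lambda>i. \<xi> (i + k)) {1..}" by simp
qed (simp add: distr_step)

text \<open>The common source of the independence claims below: step \<open>m\<close> and all other
  steps form two disjoint blocks, and \<open>V\<close> is a measurable function \<open>G\<close> of
  the second block.\<close>

lemma indep_pair_others:
  assumes "m \<ge> 1" and G: "G \<in> PiM ({1..} - {m}) (\<lambda>_. borel) \<rightarrow>\<^sub>M N"
    and V: "\<And>\<omega>. V \<omega> = G (restrict (\<lambda>i. \<xi> i \<omega>) ({1..} - {m}))"
  shows "indep_pair borel (\<xi> m) N V"
proof -
  let ?A = "\<lambda>\<omega>. restrict (\<lambda>i. \<xi> i \<omega>) {m}" and ?B = "\<lambda>\<omega>. restrict (\<lambda>i. \<xi> i \<omega>) ({1..} - {m})"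
  let ?PA = "PiM {m} (\<lambda>_. borel :: real measure)" and ?PB = "PiM ({1..} - {m}) (\<lambda>_. borel :: real measure)"
  have "indep_var ?PA ?A ?PB ?B"
    using assms(1) by (intro indep_var_restrict[OF indep]) auto
  then have A[measurable]: "?A \<in> P \<rightarrow>\<^sub>M ?PA" and B[measurable]: "?B \<in> P \<rightarrow>\<^sub>M ?PB"
    and eq: "distr P ?PA ?A \<Otimes>\<^sub>M distr P ?PB ?B = distr P (?PA \<Otimes>\<^sub>M ?PB) (\<lambda>\<omega>. (?A \<omega>, ?B \<omega>))"
    by (auto simp: indep_var_distribution_eq)
  have m[measurable]: "(\<lambda>f. f m) \<in> ?PA \<rightarrow>\<^sub>M borel" by simp
  note G[measurable]
  have V_eq: "V = G \<circ> ?B" by (auto simp: V)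
  have xi_eq: "\<xi> m = (\<lambda>f. f m) \<circ> ?A" by auto
  have V_meas: "V \<in> P \<rightarrow>\<^sub>M N" unfolding V_eq by (rule measurable_comp) measurable
  have "distr P borel (\<xi> m) \<Otimes>\<^sub>M distr P N V = distr (distr P ?PA ?A) borel (\<lambda>f. f m) \<Otimes>\<^sub>M distr (distr P ?PB ?B) N G"
    unfolding V_eq xi_eq by (simp only: distr_distr m G A B)
  also have "\<dots> = distr (distr P ?PA ?A \<Otimes>\<^sub>M distr P ?PB ?B) (borel \<Otimes>\<^sub>M N) (\<lambda>(f, g). (f m, G g))"
  proof (rule pair_measure_distr)
    have "distr (distr P ?PB ?B) N G = distr P N V" unfolding V_eq by (simp only: distr_distr G B)
    then show "sigma_finite_measure (distr (distr P ?PB ?B) N G)"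
      using V_meas by (simp add: prob_space_distr prob_space_imp_sigma_finite)
  qed (use m G in simp_all)
  also have "\<dots> = distr P (borel \<Otimes>\<^sub>M N) ((\<lambda>(f, g). (f m, G g)) \<circ> (\<lambda>\<omega>. (?A \<omega>, ?B \<omega>)))"
    unfolding eq by (rule distr_distr) measurable
  also have "(\<lambda>(f, g). (f m, G g)) \<circ> (\<lambda>\<omega>. (?A \<omega>, ?B \<omega>)) = (\<lambda>\<omega>. (\<xi> m \<omega>, V \<omega>))"
    by (auto simp: V)
  finally show ?thesis
    using V_meas measurable_step[OF assms(1)] by (simp add: indep_pair_def)
qed

lemma indep_pair_walk_max_shift: "indep_pair borel (\<xi> 1) borel (walk_max (\<lambda>i. \<xi> (Suc i)) n)"
proof (rule indep_pair_others)
  show "walk_max (\<lambda>i f. f (Suc i)) n \<in> borel_measurable (PiM ({1..} - {1}) (\<lambda>_. borel))"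
    by (rule measurable_walk_max) (rule measurable_component_singleton, auto)
qed (auto intro!: walk_max_cong)

lemma indep_pair_walk_walk_max:
  "indep_pair borel (\<xi> 1) borel (\<lambda>\<omega>. walk (\<lambda>i. \<xi> (Suc i)) j \<omega> + walk_max (\<lambda>i. \<xi> (Suc i + k)) n \<omega>)"
proof (rule indep_pair_others)
  show "(\<lambda>f. walk (\<lambda>i f. f (Suc i)) j f + walk_max (\<lambda>i f. f (Suc i + k)) n f) \<in>
      borel_measurable (PiM ({1..} - {1}) (\<lambda>_. borel))"
    by (intro borel_measurable_add measurable_walk measurable_walk_max)
      (rule measurable_component_singleton, auto)+
qed (auto intro!: walk_max_cong walk_cong arg_cong2[where f="(+)"])

text \<open>Isolates the step at which the large jump will occur from everything before and after
  it.\<close>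

lemma indep_pair_before_after:
  "indep_pair borel (\<xi> (Suc j)) (borel \<Otimes>\<^sub>M borel \<Otimes>\<^sub>M borel)
    (\<lambda>\<omega>. (walk \<xi> j \<omega>, walk_max \<xi> j \<omega>, walk_max (\<lambda>i. \<xi> (i + Suc j)) n \<omega>))"
proof (rule indep_pair_others)
  show "(\<lambda>f. (walk (\<lambda>i f. f i) j f, walk_max (\<lambda>i f. f i) j f, walk_max (\<lambda>i f. f (i + Suc j)) n f)) \<in>
      PiM ({1..} - {Suc j}) (\<lambda>_. borel) \<rightarrow>\<^sub>M (borel \<Otimes>\<^sub>M borel \<Otimes>\<^sub>M borel)"
    by (intro measurable_Pair measurable_walk measurable_walk_max)
      (rule measurable_component_singleton, auto)+
qed (auto intro!: walk_max_cong walk_cong)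

end

section \<open>Law of the running maximum and exponential moments of the walk\<close>

context defective_S
begin

text \<open>Ties the recursion, defined from \<open>F\<close> alone, to the given walk. The process
  is arbitrary in the induction because \<open>walk_max_Suc\<close> passes to the shifted
  steps.\<close>

lemma distr_walk_max: "iid_walk P \<xi> \<nu> \<Longrightarrow> distr P borel (walk_max \<xi> n) = max_law n"
proof (induction n arbitrary: \<xi>)
  case 0
  interpret iid_walk P \<xi> \<nu> by fact
  have "walk_max \<xi> 0 = (\<lambda>_. 0)" by auto
  then show ?case by simp
next
  case (Suc n)
  interpret iid_walk P \<xi> \<nu> by fact
  let ?V = "walk_max (\<lambda>i. \<xi> (Suc i)) n"
  have sh: "iid_walk P (\<lambda>i. \<xi> (Suc i)) \<nu>" using shift[of 1] by simp
  interpret sh: iid_walk P "\<lambda>i. \<xi> (Suc i)" \<nu> by (rule sh)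
  have [measurable]: "\<xi> 1 \<in> borel_measurable P" by (simp add: measurable_step)
  have "distr P (borel \<Otimes>\<^sub>M borel) (\<lambda>\<omega>. (\<xi> 1 \<omega>, ?V \<omega>)) = \<nu> \<Otimes>\<^sub>M max_law n"
    using indep_pair_walk_max_shift[of n] Suc.IH[OF sh] distr_step[of 1]
    by (simp add: indep_pair_def)
  then have "max_law (Suc n) = distr (distr P (borel \<Otimes>\<^sub>M borel) (\<lambda>\<omega>. (\<xi> 1 \<omega>, ?V \<omega>))) borel (\<lambda>p. max 0 (fst p + snd p))"
    by simp
  also have "\<dots> = distr P borel ((\<lambda>p. max 0 (fst p + snd p)) \<circ> (\<lambda>\<omega>. (\<xi> 1 \<omega>, ?V \<omega>)))"
    by (rule distr_distr) measurable
  also have "(\<lambda>p. max 0 (fst p + snd p)) \<circ> (\<lambda>\<omega>. (\<xi> 1 \<omega>, ?V \<omega>)) = walk_max \<xi> (Suc n)"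
    by (auto simp: walk_max_Suc)
  finally show ?case by simp
qed

text \<open>Each of the first \<open>j\<close> steps is split off by independence and contributes a
  factor \<open>\<phi>\<close>. Step \<open>Suc j\<close>, reserved for the jump, occurs neither in
  the walk nor in the restarted maximum.\<close>

lemma moment_walk_walk_max:
  "iid_walk P \<xi> \<nu> \<Longrightarrow>
    (\<integral>\<^sup>+ \<omega>. ennreal (exp (\<gamma> * (walk \<xi> j \<omega> + walk_max (\<lambda>i. \<xi> (i + Suc j)) n \<omega>))) \<partial>P) =
    ennreal (\<phi> ^ j) * (\<integral>\<^sup>+ y. ennreal (exp (\<gamma> * y)) \<partial>max_law n)"
proof (induction j arbitrary: \<xi>)
  case 0
  interpret iid_walk P \<xi> \<nu> by fact
  interpret sh: iid_walk P "\<lambda>i. \<xi> (Suc i)" \<nu> using shift[of 1] by simp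
  show ?case
    unfolding distr_walk_max[OF sh.iid_walk_axioms, symmetric]
    by (subst nn_integral_distr) auto
next
  case (Suc j)
  interpret iid_walk P \<xi> \<nu> by fact
  have sh: "iid_walk P (\<lambda>i. \<xi> (Suc i)) \<nu>" using shift[of 1] by simp
  let ?R = "\<lambda>\<omega>. walk (\<lambda>i. \<xi> (Suc i)) j \<omega> + walk_max (\<lambda>i. \<xi> (Suc i + Suc j)) n \<omega>"
  have [measurable]: "?R \<in> borel_measurable P"
    using indep_pair_walk_walk_max[of j "Suc j" n] by (simp only: indep_pair_def)
  have split: "ennreal (exp (\<gamma> * (x + r))) = ennreal (exp (\<gamma> * x)) * ennreal (exp (\<gamma> * r))" for x r
    by (simp add: distrib_left exp_add ennreal_mult)
  have "(\<integral>\<^sup>+ \<omega>. ennreal (exp (\<gamma> * (walk \<xi> (Suc j) \<omega> + walk_max (\<lambda>i. \<xi> (i + Suc (Suc j))) n \<omega>))) \<partial>P) =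
      (\<integral>\<^sup>+ \<omega>. ennreal (exp (\<gamma> * (\<xi> 1 \<omega> + ?R \<omega>))) \<partial>P)"
    by (simp add: walk_Suc_shift add_ac)
  also have "\<dots> = (\<integral>\<^sup>+ \<omega>. (\<integral>\<^sup>+ x. ennreal (exp (\<gamma> * (x + ?R \<omega>))) \<partial>distr P borel (\<xi> 1)) \<partial>P)"
    using indep_pair_nn_integral[OF indep_pair_walk_walk_max[of j "Suc j" n], of "\<lambda>p. ennreal (exp (\<gamma> * (fst p + snd p)))"]
    by simp
  also have "\<dots> = (\<integral>\<^sup>+ \<omega>. (\<integral>\<^sup>+ x. ennreal (exp (\<gamma> * x)) * ennreal (exp (\<gamma> * ?R \<omega>)) \<partial>\<nu>) \<partial>P)"
    unfolding distr_step[OF order_refl] by (intro nn_integral_cong split)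
  also have "\<dots> = (\<integral>\<^sup>+ \<omega>. ennreal \<phi> * ennreal (exp (\<gamma> * ?R \<omega>)) \<partial>P)"
    using moment_eq by (simp add: nn_integral_multc exp_moment_def)
  also have "\<dots> = ennreal \<phi> * (\<integral>\<^sup>+ \<omega>. ennreal (exp (\<gamma> * ?R \<omega>)) \<partial>P)"
    by (rule nn_integral_cmult) measurable
  also have "(\<integral>\<^sup>+ \<omega>. ennreal (exp (\<gamma> * ?R \<omega>)) \<partial>P) = ennreal (\<phi> ^ j) * (\<integral>\<^sup>+ y. ennreal (exp (\<gamma> * y)) \<partial>max_law n)"
    using Suc.IH[OF sh] by simp
  finally show ?case
    by (simp add: phi_nonneg ennreal_mult mult.assoc)
qed

end

section \<open>Asymptotics of the supremum\<close>

locale S_walk = defective_S F \<gamma> + iid_walk P \<xi> "interval_measure F"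
  for F \<gamma> and P :: "'a measure" and \<xi>
begin

definition "moment n = enn2real (\<integral>\<^sup>+ y. ennreal (exp (\<gamma> * y)) \<partial>max_law n)"
definition "m = enn2real (exp_moment_sup P \<xi> \<gamma>)"
definition "p x = prob {\<omega> \<in> space P. ereal x < walk_sup \<xi> \<omega>}"

lemma ennreal_moment: "(\<integral>\<^sup>+ y. ennreal (exp (\<gamma> * y)) \<partial>max_law n) = ennreal (moment n)"
  unfolding moment_def using max_law_moment[of n]
  by (intro ennreal_enn2real[symmetric]) (auto simp: less_top[symmetric] top_unique)

lemma exp_moment_sup_eq: "exp_moment_sup P \<xi> \<gamma> = (SUP n. ennreal (moment n))"
proof -
  have "exp_moment_sup P \<xi> \<gamma> = (\<integral>\<^sup>+ \<omega>. (SUP n. ennreal (exp (\<gamma> * walk_max \<xi> n \<omega>))) \<partial>P)"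
    by (simp add: exp_moment_sup_def exp_ext_walk_sup gamma_pos)
  also have "\<dots> = (SUP n. \<integral>\<^sup>+ \<omega>. ennreal (exp (\<gamma> * walk_max \<xi> n \<omega>)) \<partial>P)"
    using gamma_pos
    by (intro nn_integral_monotone_convergence_SUP)
      (auto simp: incseq_def le_fun_def intro!: ennreal_leI walk_max_mono)
  also have "(\<lambda>n. \<integral>\<^sup>+ \<omega>. ennreal (exp (\<gamma> * walk_max \<xi> n \<omega>)) \<partial>P) = (\<lambda>n. ennreal (moment n))"
    by (simp add: ennreal_moment[symmetric] distr_walk_max[OF iid_walk_axioms, symmetric] nn_integral_distr)
  finally show ?thesis .
qed

lemma exp_moment_sup_finite: "exp_moment_sup P \<xi> \<gamma> < \<infinity>"
proof -
  have "exp_moment_sup P \<xi> \<gamma> \<le> ennreal (1 / (1 - \<phi>))"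
    unfolding exp_moment_sup_eq using max_law_moment by (intro SUP_least) (simp add: ennreal_moment[symmetric])
  then show ?thesis by (simp add: le_less_trans)
qed

lemma ennreal_m: "exp_moment_sup P \<xi> \<gamma> = ennreal m"
  unfolding m_def using exp_moment_sup_finite by (simp add: less_top)

lemma m_nonneg: "0 \<le> m"
  by (simp add: m_def)

lemma moment_nonneg: "0 \<le> moment n"
  by (simp add: moment_def)

lemma moment_pos: "0 < moment n"
proof -
  interpret N: real_distribution "max_law n" by (rule real_distribution_max_law)
  have "(\<integral>\<^sup>+ y. ennreal (exp (\<gamma> * y)) \<partial>max_law n) \<noteq> 0"
  proof
    assume "(\<integral>\<^sup>+ y. ennreal (exp (\<gamma> * y)) \<partial>max_law n) = 0"
    then have "AE y in max_law n. ennreal (exp (\<gamma> * y)) = 0"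
      by (subst (asm) nn_integral_0_iff_AE) auto
    then show False by simp
  qed
  then show ?thesis
    using moment_nonneg[of n] by (auto simp: ennreal_moment less_le)
qed

text \<open>The lower bound will only see the maximum over finitely many steps after the jump; this
  limit recovers the moment of the full supremum.\<close>

lemma moment_tendsto: "moment \<longlonglongrightarrow> m"
proof -
  have "ennreal (moment k) \<le> ennreal (moment n)" if "k \<le> n" for k n
  proof -
    have "(\<integral>\<^sup>+ \<omega>. ennreal (exp (\<gamma> * walk_max \<xi> k \<omega>)) \<partial>P) \<le> (\<integral>\<^sup>+ \<omega>. ennreal (exp (\<gamma> * walk_max \<xi> n \<omega>)) \<partial>P)"
      using gamma_pos that by (intro nn_integral_mono ennreal_leI) (simp add: walk_max_mono)
    then show ?thesis
      by (simp add: ennreal_moment[symmetric] distr_walk_max[OF iid_walk_axioms, symmetric] nn_integral_distr)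
  qed
  then have "(\<lambda>n. ennreal (moment n)) \<longlonglongrightarrow> ennreal m"
    unfolding ennreal_m[symmetric] exp_moment_sup_eq by (intro LIMSEQ_SUP) (simp add: incseq_def)
  then show ?thesis using m_nonneg moment_nonneg by simp
qed

text \<open>\<open>exp_ext\<close> is infinite where the supremum is, so a finite exponential moment
  makes that set null.\<close>

lemma AE_walk_sup_finite: "AE \<omega> in P. walk_sup \<xi> \<omega> \<noteq> \<infinity>"
proof -
  have eq: "exp_ext \<gamma> (walk_sup \<xi> \<omega>) = (SUP n. ennreal (exp (\<gamma> * walk_max \<xi> n \<omega>)))" for \<omega>
    by (rule exp_ext_walk_sup[OF gamma_pos])
  have "AE \<omega> in P. exp_ext \<gamma> (walk_sup \<xi> \<omega>) \<noteq> \<infinity>"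
  proof (rule nn_integral_noteq_infinite)
    show "(\<lambda>\<omega>. exp_ext \<gamma> (walk_sup \<xi> \<omega>)) \<in> borel_measurable P"
      unfolding eq by measurable
    show "(\<integral>\<^sup>+ \<omega>. exp_ext \<gamma> (walk_sup \<xi> \<omega>) \<partial>P) \<noteq> \<infinity>"
      using exp_moment_sup_finite by (simp add: exp_moment_sup_def)
  qed
  then show ?thesis
    by (rule AE_mp) (auto simp: exp_ext_def)
qed

lemma max_law_tail_eq: "measure (max_law n) {x<..} = prob {\<omega> \<in> space P. x < walk_max \<xi> n \<omega>}"
  unfolding distr_walk_max[OF iid_walk_axioms, symmetric]
  by (subst measure_distr) (auto intro!: arg_cong[where f=prob])

lemma max_law_tail_tendsto: "(\<lambda>n. measure (max_law n) {x<..}) \<longlonglongrightarrow> p x"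
proof -
  have "(\<lambda>n. prob {\<omega> \<in> space P. x < walk_max \<xi> n \<omega>}) \<longlonglongrightarrow> prob (\<Union>n. {\<omega> \<in> space P. x < walk_max \<xi> n \<omega>})"
    by (rule finite_Lim_measure_incseq) (auto simp: incseq_def intro: less_le_trans walk_max_mono)
  also have "(\<Union>n. {\<omega> \<in> space P. x < walk_max \<xi> n \<omega>}) = {\<omega> \<in> space P. ereal x < walk_sup \<xi> \<omega>}"
    by (auto simp: less_walk_sup_iff)
  finally show ?thesis by (simp add: max_law_tail_eq p_def)
qed

lemma max_law_tail_le: "measure (max_law n) {x<..} \<le> p x"
  unfolding max_law_tail_eq p_def
  by (rule finite_measure_mono) (auto simp: less_walk_sup_iff)

text \<open>A real-valued version of the supremum; the default value \<open>0\<close> at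
  \<open>\<infinity>\<close> affects only a null set.\<close>

definition "R \<omega> = real_of_ereal (walk_sup \<xi> \<omega>)"

lemma R_measurable[measurable]: "R \<in> borel_measurable P"
  unfolding R_def[abs_def] by measurable

lemma AE_R: "AE \<omega> in P. walk_sup \<xi> \<omega> = ereal (R \<omega>)"
  using AE_walk_sup_finite
proof eventually_elim
  case (elim \<omega>)
  then show ?case
    using walk_sup_nonneg[of \<xi> \<omega>] by (cases "walk_sup \<xi> \<omega>") (auto simp: R_def)
qed

lemma integrable_exp_R: "integrable P (\<lambda>\<omega>. exp (\<gamma> * R \<omega>))"
  and integral_exp_R: "expectation (\<lambda>\<omega>. exp (\<gamma> * R \<omega>)) = m"
proof -
  have "(\<integral>\<^sup>+ \<omega>. ennreal (exp (\<gamma> * R \<omega>)) \<partial>P) = exp_moment_sup P \<xi> \<gamma>"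
    unfolding exp_moment_sup_def
    by (rule nn_integral_cong_AE, use AE_walk_sup_finite in eventually_elim) (simp add: exp_ext_def R_def)
  then have "has_bochner_integral P (\<lambda>\<omega>. exp (\<gamma> * R \<omega>)) m"
    by (intro has_bochner_integral_nn_integral) (auto simp: m_nonneg ennreal_m)
  then show "integrable P (\<lambda>\<omega>. exp (\<gamma> * R \<omega>))" "expectation (\<lambda>\<omega>. exp (\<gamma> * R \<omega>)) = m"
    by (auto simp: has_bochner_integral_iff)
qed

section \<open>Upper bound for the tail of the supremum\<close>

lemma p_recursion_le:
  assumes a: "\<And>z. z \<ge> A \<Longrightarrow> p z \<le> a * T z" and x: "x \<ge> 0"
  shows "p x \<le> a * (tail (conv2 F) x - (\<integral>z. T (x - min A z) \<partial>\<nu>)) + expectation (\<lambda>\<omega>. T (x - min A (R \<omega>)))"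
\<comment> \<open>The recursion is applied at finite horizons, where every tail is below
  \<open>p\<close>, and then passed to the limit. \<open>LIMSEQ_Suc\<close> is needed because it
  bounds the law with index \<open>Suc n\<close>.\<close>
proof (rule LIMSEQ_le_const2[OF LIMSEQ_Suc[OF max_law_tail_tendsto]], intro exI[of _ 0] allI impI)
  fix n
  have meas: "(\<lambda>z. T (x - min A z)) \<in> borel_measurable borel" by measurable
  have int: "integrable P (\<lambda>\<omega>. T (x - min A (Y \<omega>)))" if [measurable]: "Y \<in> borel_measurable P" for Y
    by (rule integrable_const_bound[where B=1]) (auto simp: tail_nonneg tail_le_1)
  have "measure (max_law (Suc n)) {x<..} = measure (\<nu> \<Otimes>\<^sub>M max_law n) {p. fst p + snd p > x}"
    by (rule max_law_Suc_tail[OF x])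
  also have "\<dots> \<le> a * (tail (conv2 F) x - (\<integral>z. T (x - min A z) \<partial>\<nu>)) + (\<integral>z. T (x - min A z) \<partial>max_law n)"
    by (rule sum_tail_le) (auto intro!: real_distribution_max_law order_trans[OF max_law_tail_le a])
  also have "(\<integral>z. T (x - min A z) \<partial>max_law n) = expectation (\<lambda>\<omega>. T (x - min A (walk_max \<xi> n \<omega>)))"
    unfolding distr_walk_max[OF iid_walk_axioms, symmetric] by (rule integral_distr[OF _ meas]) simp
  also have "\<dots> \<le> expectation (\<lambda>\<omega>. T (x - min A (R \<omega>)))"
  proof (rule integral_mono_AE)
    show "AE \<omega> in P. T (x - min A (walk_max \<xi> n \<omega>)) \<le> T (x - min A (R \<omega>))"
      using AE_R
    proof eventually_elim
      case (elim \<omega>)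
      then have "walk_max \<xi> n \<omega> \<le> R \<omega>" using walk_max_le_walk_sup[of \<xi> n \<omega>] by simp
      then show ?case by (intro tail_antimono) auto
    qed
  qed (auto intro!: int)
  finally show "measure (max_law (Suc n)) {x<..} \<le>
    a * (tail (conv2 F) x - (\<integral>z. T (x - min A z) \<partial>\<nu>)) + expectation (\<lambda>\<omega>. T (x - min A (R \<omega>)))"
    by simp
qed

text \<open>In \<open>p_recursion_le\<close> the convolution part costs about
  \<open>\<phi> * a\<close>, and the truncated expectation, divided by \<open>T x\<close>, has a
  limit of at most \<open>m\<close>. The cutoff \<open>A\<close> is fixed before \<open>x\<close>
  tends to infinity.\<close>

lemma p_bound_improve:
  assumes a: "a \<ge> 0" "\<forall>\<^sub>F x in at_top. p x \<le> a * T x" and "\<epsilon> > 0"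
  shows "\<forall>\<^sub>F x in at_top. p x \<le> (\<phi> * a + m + \<epsilon>) * T x"
proof -
  \<comment> \<open>Keeps \<open>a * \<delta>\<close> below \<open>\<epsilon> / 2\<close>; the
    summand \<open>1\<close> covers \<open>a = 0\<close>.\<close>
  define \<delta> where "\<delta> = \<epsilon> / (2 * (a + 1))"
  have \<delta>: "\<delta> > 0" "a * \<delta> \<le> \<epsilon> / 2"
    using assms by (auto simp: \<delta>_def field_simps)
  have "\<forall>\<^sub>F A in at_top. (\<forall>z\<ge>A. p z \<le> a * T z) \<and>
      (\<forall>\<^sub>F x in at_top. tail (conv2 F) x - (\<integral>z. T (x - min A z) \<partial>\<nu>) \<le> (\<phi> + \<delta>) * T x)"
    using conv2_remainder_le[OF \<delta>(1)] eventually_all_ge_at_top[OF a(2)] by eventually_elim auto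
  from eventually_happens[OF this] obtain A where A: "\<And>z. z \<ge> A \<Longrightarrow> p z \<le> a * T z"
    and conv: "\<forall>\<^sub>F x in at_top. tail (conv2 F) x - (\<integral>z. T (x - min A z) \<partial>\<nu>) \<le> (\<phi> + \<delta>) * T x"
    by auto
  have dR: "real_distribution (distr P borel R)" by simp
  have eqR: "(\<integral>z. f (min A z) \<partial>distr P borel R) = expectation (\<lambda>\<omega>. f (min A (R \<omega>)))"
    if [measurable]: "f \<in> borel_measurable borel" for f :: "real \<Rightarrow> real"
    by (rule integral_distr) measurable
  have "(\<integral>z. exp (\<gamma> * min A z) \<partial>distr P borel R) = expectation (\<lambda>\<omega>. exp (\<gamma> * min A (R \<omega>)))"
    by (rule eqR) measurable
  also have "\<dots> \<le> expectation (\<lambda>\<omega>. exp (\<gamma> * R \<omega>))"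
  proof (rule integral_mono[OF _ integrable_exp_R])
    show "integrable P (\<lambda>\<omega>. exp (\<gamma> * min A (R \<omega>)))"
      by (rule Bochner_Integration.integrable_bound[OF integrable_exp_R]) (use gamma_pos in auto)
  qed (use gamma_pos in auto)
  also have "\<dots> < m + \<epsilon> / 2" using assms(3) by (simp add: integral_exp_R)
  finally have "\<forall>\<^sub>F x in at_top. (\<integral>z. T (x - min A z) \<partial>distr P borel R) / T x < m + \<epsilon> / 2"
    by (rule order_tendstoD(2)[OF tendsto_integral_tail_min[OF dR]])
  with conv show ?thesis using eventually_ge_at_top[of 0]
  proof eventually_elim
    case (elim x)
    have "p x \<le> a * (tail (conv2 F) x - (\<integral>z. T (x - min A z) \<partial>\<nu>)) + expectation (\<lambda>\<omega>. T (x - min A (R \<omega>)))"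
      using A elim by (intro p_recursion_le)
    also have "a * (tail (conv2 F) x - (\<integral>z. T (x - min A z) \<partial>\<nu>)) \<le> a * ((\<phi> + \<delta>) * T x)"
      using elim a by (intro mult_left_mono) auto
    also have "expectation (\<lambda>\<omega>. T (x - min A (R \<omega>))) \<le> (m + \<epsilon> / 2) * T x"
      using elim(2) tail_pos[of x] eqR[of "\<lambda>z. T (x - z)"] by (simp add: pos_divide_less_eq less_imp_le)
    also have "a * ((\<phi> + \<delta>) * T x) + (m + \<epsilon> / 2) * T x = (\<phi> * a + m + (a * \<delta> + \<epsilon> / 2)) * T x"
      by (simp add: algebra_simps)
    also have "\<dots> \<le> (\<phi> * a + m + \<epsilon>) * T x"
      using \<delta>(2) by (intro mult_right_mono tail_nonneg) auto
    finally show ?case by simp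
  qed
qed

text \<open>The infimum \<open>u\<close> of all eventual bounds satisfies \<open>u \<le> \<phi> * u + m\<close>.\<close>

lemma p_upper:
  assumes "\<epsilon> > 0"
  shows "\<forall>\<^sub>F x in at_top. p x \<le> (m / (1 - \<phi>) + \<epsilon>) * T x"
proof -
  define B where "B = {a. a \<ge> 0 \<and> (\<forall>\<^sub>F x in at_top. p x \<le> a * T x)}"
  define u where "u = Inf B"
  \<comment> \<open>The bound uniform in \<open>n\<close> supplies an element of \<open>B\<close>,
    so that the infimum is meaningful.\<close>
  obtain K where K: "\<And>n x. measure (max_law n) {x<..} \<le> K * T x" "K \<ge> 0"
    using max_law_tail_bound by blast
  have "p x \<le> K * T x" for x
    by (rule LIMSEQ_le_const2[OF max_law_tail_tendsto]) (use K in auto)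
  then have "K \<in> B" using K by (simp add: B_def)
  then have ne: "B \<noteq> {}" by auto
  have bdd: "bdd_below B" by (auto simp: B_def intro: bdd_belowI[of _ 0])
  \<comment> \<open>Solved for \<open>a\<close>, the improved bound becomes a lower bound of the
    whole set \<open>B\<close> and hence of its infimum \<open>u\<close>.\<close>
  have "(u - m) / \<phi> \<le> a" if "a \<in> B" for a
  proof -
    have "u \<le> \<phi> * a + m + e" if "e > 0" for e
    proof -
      have "\<phi> * a + m + e \<in> B"
        using p_bound_improve[of a e] \<open>a \<in> B\<close> that phi_nonneg m_nonneg by (auto simp: B_def)
      then show ?thesis unfolding u_def by (rule cInf_lower[OF _ bdd])
    qed
    then have "u \<le> \<phi> * a + m" by (rule field_le_epsilon)
    then have "u - m \<le> a * \<phi>" by (simp add: mult.commute)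
    then show ?thesis using phi_pos by (simp only: pos_divide_le_eq)
  qed
  then have "(u - m) / \<phi> \<le> u" unfolding u_def by (intro cInf_greatest[OF ne]) simp
  then have "u - m \<le> u * \<phi>" using phi_pos by (simp only: pos_divide_le_eq)
  then have "u * (1 - \<phi>) \<le> m" by (simp add: right_diff_distrib)
  then have "u \<le> m / (1 - \<phi>)" using phi_less_1 by (simp add: pos_le_divide_eq)
  then have "Inf B < m / (1 - \<phi>) + \<epsilon>" using assms by (simp add: u_def)
  then obtain a where "a \<in> B" "a < m / (1 - \<phi>) + \<epsilon>"
    using cInf_lessD[OF ne] by blast
  then have "\<forall>\<^sub>F x in at_top. p x \<le> a * T x" by (simp add: B_def)
  then show ?thesis
  proof eventually_elim
    case (elim x)
    also have "a * T x \<le> (m / (1 - \<phi>) + \<epsilon>) * T x"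
      using \<open>a < _\<close> by (intro mult_right_mono tail_nonneg) auto
    finally show ?case .
  qed
qed

section \<open>Lower bound for the joint event through a single large jump\<close>

definition "first_jump h j n x = {\<omega> \<in> space P. walk_max \<xi> j \<omega> \<le> h x \<and> x - h x < walk \<xi> (Suc j) \<omega> \<and>
   x < walk \<xi> (Suc j) \<omega> + walk_max (\<lambda>i. \<xi> (i + Suc j)) n \<omega>}" for h :: "real \<Rightarrow> real"

text \<open>With \<open>Z\<close> the maximum after the jump, the two conditions on step
  \<open>Suc j\<close> combine into exceeding
  \<open>x - (walk \<xi> j \<omega> + min (h x) Z)\<close>. Integrating out this independent step
  turns them into a value of \<open>T\<close>.\<close>

lemma emeasure_first_jump:
  "emeasure P (first_jump h j n x) = (\<integral>\<^sup>+ \<omega>. ennreal (indicator {..h x} (walk_max \<xi> j \<omega>) *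
     T (x - (walk \<xi> j \<omega> + min (h x) (walk_max (\<lambda>i. \<xi> (i + Suc j)) n \<omega>)))) \<partial>P)"
  and first_jump_measurable[measurable]: "first_jump h j n x \<in> sets P"
proof -
  interpret sh: iid_walk P "\<lambda>i. \<xi> (i + Suc j)" \<nu> by (rule shift)
  let ?Z = "walk_max (\<lambda>i. \<xi> (i + Suc j)) n"
  show [measurable]: "first_jump h j n x \<in> sets P"
    unfolding first_jump_def by measurable
  \<comment> \<open>The components are the jump, the walk before it, the maximum before it and the
    maximum after it.\<close>
  let ?g = "\<lambda>(y, s, b, z). indicator {..h x} b * indicator {x - (s + min (h x) z)<..} y :: ennreal"
  have g: "?g \<in> borel_measurable (borel \<Otimes>\<^sub>M borel \<Otimes>\<^sub>M borel \<Otimes>\<^sub>M borel)"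
    unfolding split_beta' indicator_def greaterThan_iff atMost_iff by measurable
  have "emeasure P (first_jump h j n x) = (\<integral>\<^sup>+ \<omega>. indicator (first_jump h j n x) \<omega> \<partial>P)"
    by simp
  also have "\<dots> = (\<integral>\<^sup>+ \<omega>. ?g (\<xi> (Suc j) \<omega>, walk \<xi> j \<omega>, walk_max \<xi> j \<omega>, ?Z \<omega>) \<partial>P)"
    by (intro nn_integral_cong) (auto simp: first_jump_def indicator_def walk_Suc min_def)
  also have "\<dots> = (\<integral>\<^sup>+ \<omega>. (\<integral>\<^sup>+ y. ?g (y, walk \<xi> j \<omega>, walk_max \<xi> j \<omega>, ?Z \<omega>) \<partial>distr P borel (\<xi> (Suc j))) \<partial>P)"
    by (rule indep_pair_nn_integral[OF indep_pair_before_after g])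
  also have "\<dots> = (\<integral>\<^sup>+ \<omega>. ennreal (indicator {..h x} (walk_max \<xi> j \<omega>) * T (x - (walk \<xi> j \<omega> + min (h x) (?Z \<omega>)))) \<partial>P)"
  proof (intro nn_integral_cong)
    fix \<omega>
    have "(\<integral>\<^sup>+ y. ?g (y, walk \<xi> j \<omega>, walk_max \<xi> j \<omega>, ?Z \<omega>) \<partial>\<nu>) =
        indicator {..h x} (walk_max \<xi> j \<omega>) * emeasure \<nu> {x - (walk \<xi> j \<omega> + min (h x) (?Z \<omega>))<..}"
      by (simp add: nn_integral_cmult)
    then show "(\<integral>\<^sup>+ y. ?g (y, walk \<xi> j \<omega>, walk_max \<xi> j \<omega>, ?Z \<omega>) \<partial>distr P borel (\<xi> (Suc j))) =
        ennreal (indicator {..h x} (walk_max \<xi> j \<omega>) * T (x - (walk \<xi> j \<omega> + min (h x) (?Z \<omega>))))"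
      by (simp add: distr_step nu.emeasure_eq_measure measure_nu_tail indicator_def)
  qed
  finally show "emeasure P (first_jump h j n x) = \<dots>" .
qed

text \<open>For a fixed path the integrand divided by \<open>T x\<close> tends to the exponential of
  \<open>\<gamma>\<close> times the walk without its jump. Fatou's lemma gives the lower bound
  without any majorant.\<close>

lemma first_jump_lower:
  fixes h :: "real \<Rightarrow> real"
  assumes h: "filterlim h at_top at_top" and \<theta>: "\<theta> < 1"
  shows "\<forall>\<^sub>F x in at_top. \<theta> * (\<phi> ^ j * moment n) * T x \<le> prob (first_jump h j n x)"
proof (rule eventually_at_top_sequentiallyI)
  fix X :: "nat \<Rightarrow> real" assume X: "filterlim X at_top sequentially"
  interpret sh: iid_walk P "\<lambda>i. \<xi> (i + Suc j)" \<nu> by (rule shift)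
  let ?Z = "walk_max (\<lambda>i. \<xi> (i + Suc j)) n"
  define g where "g k \<omega> = indicator {..h (X k)} (walk_max \<xi> j \<omega>) *
     T (X k - (walk \<xi> j \<omega> + min (h (X k)) (?Z \<omega>))) / T (X k)" for k \<omega>
  have hX: "filterlim (\<lambda>k. h (X k)) at_top sequentially"
    by (rule filterlim_compose[OF h X])
  have lim: "(\<lambda>k. g k \<omega>) \<longlonglongrightarrow> exp (\<gamma> * (walk \<xi> j \<omega> + ?Z \<omega>))" for \<omega>
  proof -
    \<comment> \<open>Once \<open>h (X k)\<close> exceeds both maxima, the indicator is
      \<open>1\<close> and the truncation is inactive.\<close>
    have "\<forall>\<^sub>F k in sequentially. h (X k) \<ge> max (walk_max \<xi> j \<omega>) (?Z \<omega>)"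
      using hX unfolding filterlim_at_top by blast
    then have "\<forall>\<^sub>F k in sequentially. T (X k - (walk \<xi> j \<omega> + ?Z \<omega>)) / T (X k) = g k \<omega>"
      by eventually_elim (simp add: g_def min_absorb2)
    then show ?thesis
      by (rule Lim_transform_eventually[OF filterlim_compose[OF tail_ratio X]])
  qed
  have g_int: "(\<integral>\<^sup>+ \<omega>. ennreal (g k \<omega>) \<partial>P) = ennreal (prob (first_jump h j n (X k)) / T (X k))" for k
  proof -
    let ?f = "\<lambda>\<omega>. indicator {..h (X k)} (walk_max \<xi> j \<omega>) * T (X k - (walk \<xi> j \<omega> + min (h (X k)) (?Z \<omega>)))"
    have [measurable]: "?f \<in> borel_measurable P" unfolding indicator_def by measurable
    have "(\<integral>\<^sup>+ \<omega>. ennreal (g k \<omega>) \<partial>P) = (\<integral>\<^sup>+ \<omega>. ennreal (?f \<omega>) / ennreal (T (X k)) \<partial>P)"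
      unfolding g_def using tail_pos by (intro nn_integral_cong divide_ennreal[symmetric]) (auto simp: tail_nonneg)
    also have "\<dots> = emeasure P (first_jump h j n (X k)) / ennreal (T (X k))"
      unfolding emeasure_first_jump by (rule nn_integral_divide) measurable
    also have "\<dots> = ennreal (prob (first_jump h j n (X k)) / T (X k))"
      unfolding emeasure_eq_measure using tail_pos by (intro divide_ennreal) auto
    finally show ?thesis .
  qed
  have g_meas: "(\<lambda>\<omega>. ennreal (g k \<omega>)) \<in> borel_measurable P" for k
    unfolding g_def indicator_def by measurable
  have "ennreal (\<phi> ^ j * moment n) = (\<integral>\<^sup>+ \<omega>. ennreal (exp (\<gamma> * (walk \<xi> j \<omega> + ?Z \<omega>))) \<partial>P)"
    using moment_walk_walk_max[OF iid_walk_axioms, of j n]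
    by (simp add: ennreal_moment ennreal_mult phi_nonneg moment_nonneg)
  also have "\<dots> = (\<integral>\<^sup>+ \<omega>. liminf (\<lambda>k. ennreal (g k \<omega>)) \<partial>P)"
    by (intro nn_integral_cong lim_imp_Liminf[symmetric] tendsto_ennrealI lim) simp
  also have "\<dots> \<le> liminf (\<lambda>k. \<integral>\<^sup>+ \<omega>. ennreal (g k \<omega>) \<partial>P)"
    by (rule nn_integral_liminf) (rule g_meas)
  finally have le: "ennreal (\<phi> ^ j * moment n) \<le> liminf (\<lambda>k. ennreal (prob (first_jump h j n (X k)) / T (X k)))"
    by (simp add: g_int)
  \<comment> \<open>Positivity and \<open>\<theta> < 1\<close> give the strict inequality needed to
    pass from a \<open>liminf\<close> to an eventual bound.\<close>
  have pos: "0 < \<phi> ^ j * moment n" using phi_pos moment_pos by simp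
  then have "ennreal (\<theta> * (\<phi> ^ j * moment n)) < ennreal (\<phi> ^ j * moment n)"
    using mult_strict_right_mono[OF \<theta> pos] by (intro ennreal_lessI) auto
  also note le
  finally have "\<forall>\<^sub>F k in sequentially.
      ennreal (\<theta> * (\<phi> ^ j * moment n)) < ennreal (prob (first_jump h j n (X k)) / T (X k))"
    by (rule less_LiminfD)
  then show "\<forall>\<^sub>F k in sequentially. \<theta> * (\<phi> ^ j * moment n) * T (X k) \<le> prob (first_jump h j n (X k))"
  proof eventually_elim
    case (elim k)
    then have "\<theta> * (\<phi> ^ j * moment n) < prob (first_jump h j n (X k)) / T (X k)"
      by (meson ennreal_leI not_less)
    then show ?case using tail_pos[of "X k"] by (simp only: pos_less_divide_eq less_imp_le)
  qed
qed


lemma event_A_measurable[measurable]: "event_A P \<xi> n a x \<in> sets P"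
  unfolding event_A_def by measurable

text \<open>The joint probability for the infinite window, up to the null set where the supremum is
  \<open>\<infinity>\<close>.\<close>

definition "J h x = prob ({\<omega> \<in> space P. ereal x < walk_sup \<xi> \<omega>} \<inter> (\<Union>n\<in>{1..}. event_A P \<xi> n (h x) (x - h x)))"
  for h :: "real \<Rightarrow> real"

lemma J_le_p: "J h x \<le> p x"
  unfolding J_def p_def by (rule finite_measure_mono) auto

text \<open>The maximum after the jump is attained at some step \<open>i\<close>, and then the walk
  at time \<open>Suc j + i\<close> lies above \<open>x\<close>.\<close>

lemma first_jump_subset:
  "first_jump h j n x \<subseteq> {\<omega> \<in> space P. ereal x < walk_sup \<xi> \<omega>} \<inter> event_A P \<xi> (Suc j) (h x) (x - h x)"
proof
  fix \<omega> assume \<omega>: "\<omega> \<in> first_jump h j n x"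
  obtain i where "walk_max (\<lambda>i. \<xi> (i + Suc j)) n \<omega> = walk (\<lambda>i. \<xi> (i + Suc j)) i \<omega>"
    using walk_max_attained[of n "\<lambda>i. \<xi> (i + Suc j)" \<omega>] by auto
  then have "x < walk \<xi> (Suc j + i) \<omega>"
    using \<omega> walk_add[of \<xi> "Suc j" i \<omega>] by (simp add: first_jump_def)
  then have "x < walk_max \<xi> (Suc j + i) \<omega>"
    by (rule less_le_trans) (rule walk_le_walk_max, simp)
  with \<omega> show "\<omega> \<in> {\<omega> \<in> space P. ereal x < walk_sup \<xi> \<omega>} \<inter> event_A P \<xi> (Suc j) (h x) (x - h x)"
    by (auto simp: first_jump_def event_A_def less_walk_sup_iff)
qed

text \<open>The events are disjoint since \<open>h x \<le> x - h x\<close>: after exceeding \<open>x - h x\<close> the running maximum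
  is above \<open>h x\<close>.\<close>

lemma disjoint_first_jump:
  assumes "h x \<le> x / 2"
  shows "disjoint_family (\<lambda>j. first_jump h j n x)"
proof -
  have "first_jump h j n x \<inter> first_jump h k n x = {}" if "j < k" for j k
  proof -
    have False if "\<omega> \<in> first_jump h j n x" "\<omega> \<in> first_jump h k n x" for \<omega>
    proof -
      have "walk \<xi> (Suc j) \<omega> \<le> walk_max \<xi> k \<omega>"
        using \<open>j < k\<close> by (intro walk_le_walk_max) simp
      then show False using that assms by (simp add: first_jump_def)
    qed
    then show ?thesis by auto
  qed
  then show ?thesis
    unfolding disjoint_family_on_def by (metis Int_commute linorder_neqE_nat)
qed

text \<open>Summing over the disjoint jump times gives a partial geometric series times a moment,
  which tends to \<open>m / (1 - \<phi>)\<close>.\<close>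

lemma J_lower:
  fixes h :: "real \<Rightarrow> real"
  assumes h: "filterlim h at_top at_top" "\<And>x. x > 0 \<Longrightarrow> h x \<le> x / 2" and a: "a < m / (1 - \<phi>)"
  shows "\<forall>\<^sub>F x in at_top. a * T x \<le> J h x"
proof -
  \<comment> \<open>One parameter serves both as the number of jump times and as the horizon after
    the jump, so a single limit suffices.\<close>
  define B where "B L = (\<Sum>j<L. \<phi> ^ j * moment L)" for L
  have B_nonneg: "0 \<le> B L" for L
    unfolding B_def by (intro sum_nonneg mult_nonneg_nonneg zero_le_power phi_nonneg moment_nonneg)
  have "(\<lambda>L. (\<Sum>j<L. \<phi> ^ j) * moment L) \<longlonglongrightarrow> 1 / (1 - \<phi>) * m"
    using geometric_sums[of \<phi>] phi_nonneg phi_less_1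
    by (intro tendsto_mult moment_tendsto) (auto simp: sums_def)
  then have "B \<longlonglongrightarrow> m / (1 - \<phi>)"
    by (simp add: B_def[abs_def] sum_distrib_right)
  then have "\<forall>\<^sub>F L in sequentially. a < B L" using a by (rule order_tendstoD(1))
  then obtain L where L: "a < B L" by (auto dest: eventually_happens)
  obtain \<theta> where \<theta>: "\<theta> < 1" "a \<le> \<theta> * B L"
  proof (cases "a \<le> 0")
    case True
    then show ?thesis using that[of 0] by simp
  next
    case False
    then show ?thesis using that[of "a / B L"] L by simp
  qed
  have "\<forall>\<^sub>F x in at_top. \<forall>j\<in>{..<L}. \<theta> * (\<phi> ^ j * moment L) * T x \<le> prob (first_jump h j L x)"
    by (intro eventually_ball_finite ballI first_jump_lower h \<theta>) simp
  then show ?thesis using eventually_gt_at_top[of 0]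
  proof eventually_elim
    case (elim x)
    have "a * T x \<le> \<theta> * B L * T x"
      by (intro mult_right_mono \<theta> tail_nonneg)
    also have "\<dots> = (\<Sum>j<L. \<theta> * (\<phi> ^ j * moment L) * T x)"
      by (simp add: B_def sum_distrib_left sum_distrib_right mult.assoc)
    also have "\<dots> \<le> (\<Sum>j<L. prob (first_jump h j L x))"
      using elim(1) by (intro sum_mono) auto
    also have "\<dots> = prob (\<Union>j<L. first_jump h j L x)"
      using disjoint_first_jump[of h x L, OF h(2)[OF elim(2)]]
      by (intro finite_measure_finite_Union[symmetric]) (auto simp: disjoint_family_on_def)
    also have "\<dots> \<le> J h x"
      unfolding J_def
    proof (rule finite_measure_mono)
      show "(\<Union>j<L. first_jump h j L x) \<subseteq>
          {\<omega> \<in> space P. ereal x < walk_sup \<xi> \<omega>} \<inter> (\<Union>n\<in>{1..}. event_A P \<xi> n (h x) (x - h x))"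
        using first_jump_subset[of h _ L x] by fastforce
    qed measurable
    finally show ?case .
  qed
qed

section \<open>Finite and infinite windows, and uniform convergence\<close>

lemma event_M_eq:
  "event_M P \<xi> x t = {\<omega> \<in> space P. ereal x < walk_sup \<xi> \<omega>} \<inter>
     {\<omega> \<in> space P. if t = \<infinity> then walk_sup \<xi> \<omega> \<noteq> \<infinity> else walk_sup \<xi> \<omega> \<le> ereal (x + real_of_ereal t)}"
proof -
  have "walk_sup \<xi> \<omega> \<in> ereal ` window x t \<longleftrightarrow> ereal x < walk_sup \<xi> \<omega> \<and>
    (if t = \<infinity> then walk_sup \<xi> \<omega> \<noteq> \<infinity> else walk_sup \<xi> \<omega> \<le> ereal (x + real_of_ereal t))" for \<omega>
    using walk_sup_nonneg[of \<xi> \<omega>] by (cases "walk_sup \<xi> \<omega>") (auto simp: window_def)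
  then show ?thesis by (auto simp: event_M_def)
qed

lemma event_M_measurable[measurable]: "event_M P \<xi> x t \<in> sets P"
  unfolding event_M_eq by measurable

lemma prob_event_M:
  assumes "t \<ge> 0"
  shows "prob (event_M P \<xi> x t) = p x - (if t = \<infinity> then 0 else p (x + real_of_ereal t))"
proof (cases t)
  case (real \<tau>)
  have "event_M P \<xi> x t = {\<omega> \<in> space P. ereal x < walk_sup \<xi> \<omega>} - {\<omega> \<in> space P. ereal (x + \<tau>) < walk_sup \<xi> \<omega>}"
    using real by (auto simp: event_M_eq)
  moreover have "{\<omega> \<in> space P. ereal (x + \<tau>) < walk_sup \<xi> \<omega>} \<subseteq> {\<omega> \<in> space P. ereal x < walk_sup \<xi> \<omega>}"
    using assms real by (auto intro: le_less_trans[rotated])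
  ultimately show ?thesis
    using real by (simp add: p_def finite_measure_Diff)
next
  case PInf
  have "prob (event_M P \<xi> x t) = prob {\<omega> \<in> space P. ereal x < walk_sup \<xi> \<omega>}"
    by (rule finite_measure_eq_AE, use AE_walk_sup_finite in eventually_elim) (auto simp: event_M_eq PInf)
  then show ?thesis using PInf by (simp add: p_def)
qed (use assms in simp)

text \<open>The part of the window event outside the union of the \<open>event_A\<close> grows with
  the window, so the infinite window bounds the loss for all \<open>t\<close> at once.\<close>

lemma joint_prob_bounds:
  "joint_prob P \<xi> h x t \<le> prob (event_M P \<xi> x t)"
  "prob (event_M P \<xi> x t) - joint_prob P \<xi> h x t \<le> p x - J h x"
proof -
  let ?U = "\<Union>n\<in>{1..}. event_A P \<xi> n (h x) (x - h x)"
  have U[measurable]: "?U \<in> sets P" by measurable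
  show "joint_prob P \<xi> h x t \<le> prob (event_M P \<xi> x t)"
    unfolding joint_prob_def by (rule finite_measure_mono) auto
  have "prob (event_M P \<xi> x t) - joint_prob P \<xi> h x t = prob (event_M P \<xi> x t - ?U)"
    unfolding joint_prob_def by (rule finite_measure_Diff'[symmetric]) measurable
  also have "\<dots> \<le> prob ({\<omega> \<in> space P. ereal x < walk_sup \<xi> \<omega>} - ?U)"
    by (rule finite_measure_mono) (auto simp: event_M_eq)
  also have "\<dots> = p x - J h x"
    unfolding p_def J_def by (rule finite_measure_Diff') measurable
  finally show "prob (event_M P \<xi> x t) - joint_prob P \<xi> h x t \<le> p x - J h x" .
qed

text \<open>For finite \<open>t\<close>, \<open>p (x + t) / T x\<close> is the product of
  \<open>p (x + t) / T (x + t)\<close>, close to \<open>c\<close>, and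
  \<open>T (x + t) / T x\<close>, close to \<open>exp (- \<gamma> * t)\<close> uniformly in
  \<open>t\<close>.\<close>

lemma uniform_limits:
  fixes h :: "real \<Rightarrow> real"
  assumes h: "filterlim h at_top at_top" "\<And>x. x > 0 \<Longrightarrow> h x \<le> x / 2" and "\<epsilon> > 0"
  shows "\<forall>\<^sub>F x in at_top. \<forall>t\<ge>0.
    \<bar>prob (event_M P \<xi> x t) / T x - limit_value P \<xi> F \<gamma> t\<bar> < \<epsilon> \<and>
    \<bar>1 / T x * joint_prob P \<xi> h x t - limit_value P \<xi> F \<gamma> t\<bar> < \<epsilon>"
proof -
  define c where "c = m / (1 - \<phi>)"
  have c: "c \<ge> 0" using m_nonneg phi_less_1 by (simp add: c_def)
  \<comment> \<open>The errors add up to \<open>(4 + c) * \<delta>\<close>: \<open>\<delta>\<close>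
    from \<open>p x\<close>, \<open>\<delta> + c * \<delta>\<close> from \<open>q\<close>, and
    \<open>2 * \<delta>\<close> from the gap between \<open>p x\<close> and \<open>J h x\<close>.
    The denominator \<open>c + 5\<close> makes the final bound strict.\<close>
  define \<delta> where "\<delta> = \<epsilon> / (c + 5)"
  have \<delta>: "\<delta> > 0" "(4 + c) * \<delta> < \<epsilon>"
    using c assms(3) by (auto simp: \<delta>_def field_simps)
  have up: "\<forall>\<^sub>F x in at_top. p x \<le> (c + \<delta> / 2) * T x"
    using p_upper[of "\<delta> / 2"] \<delta> by (simp add: c_def)
  have lo: "\<forall>\<^sub>F x in at_top. (c - \<delta> / 2) * T x \<le> J h x"
    using J_lower[OF h, of "c - \<delta> / 2"] \<delta> by (simp add: c_def)
  have "\<forall>\<^sub>F x in at_top. \<bar>p x / T x - c\<bar> < \<delta> \<and> \<bar>J h x / T x - c\<bar> < \<delta>"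
    using up lo
  proof eventually_elim
    case (elim x)
    have "J h x / T x \<le> p x / T x" "p x / T x \<le> c + \<delta> / 2" "c - \<delta> / 2 \<le> J h x / T x"
      using elim tail_pos[of x] J_le_p[of h x] by (simp_all add: divide_right_mono pos_divide_le_eq pos_le_divide_eq)
    then show ?case using \<delta>(1) unfolding abs_less_iff by linarith
  qed
  \<comment> \<open>The estimate is required at all points beyond \<open>x\<close>, since it is also
    applied at \<open>x + \<tau>\<close>.\<close>
  from eventually_all_ge_at_top[OF this] tail_ratio_uniform[OF \<delta>(1)]
  show ?thesis
  proof eventually_elim
    case (elim x)
    show ?case
    proof (intro allI impI)
      fix t :: ereal assume t: "t \<ge> 0"
      define e where "e = exp_minus_ext \<gamma> t"
      define q where "q = (if t = \<infinity> then 0 else p (x + real_of_ereal t))"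
      have lim: "limit_value P \<xi> F \<gamma> t = c - c * e"
        by (simp add: limit_value_def c_def e_def m_def \<phi>_def right_diff_distrib)
      have px: "\<bar>p x / T x - c\<bar> < \<delta>" and Jx: "\<bar>J h x / T x - c\<bar> < \<delta>"
        using elim(1) by auto
      have q: "\<bar>q / T x - c * e\<bar> \<le> \<delta> + c * \<delta>"
      proof (cases t)
        case (real \<tau>)
        then have \<tau>: "\<tau> \<ge> 0" using t by simp
        define r where "r = T (x + \<tau>) / T x"
        define s where "s = p (x + \<tau>) / T (x + \<tau>)"
        have qrs: "q / T x = s * r" using real by (simp add: q_def r_def s_def)
        have e: "e = exp (- \<gamma> * \<tau>)" using real by (simp add: e_def exp_minus_ext_def)
        have r: "\<bar>r - e\<bar> < \<delta>" "0 \<le> r" "r \<le> 1"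
          using elim(2) \<tau> tail_pos[of x] tail_antimono[of x "x + \<tau>"]
          by (auto simp: r_def e tail_nonneg)
        have s: "\<bar>s - c\<bar> < \<delta>" using elim(1) \<tau> by (simp add: s_def)
        have "\<bar>q / T x - c * e\<bar> = \<bar>(s - c) * r + c * (r - e)\<bar>"
          by (simp add: qrs algebra_simps)
        also have "\<dots> \<le> \<bar>s - c\<bar> * r + c * \<bar>r - e\<bar>"
          using r(2) c by (intro order_trans[OF abs_triangle_ineq]) (simp add: abs_mult)
        also have "\<dots> \<le> \<delta> * 1 + c * \<delta>"
          using r s c \<delta> by (intro add_mono mult_mono) auto
        finally show ?thesis by simp
      next
        case PInf
        then show ?thesis using c \<delta> by (simp add: q_def e_def exp_minus_ext_def)
      qed (use t in simp)
      have M: "prob (event_M P \<xi> x t) / T x = p x / T x - q / T x"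
        using prob_event_M[OF t] by (simp add: q_def diff_divide_distrib)
      have "joint_prob P \<xi> h x t / T x \<le> prob (event_M P \<xi> x t) / T x"
        "(prob (event_M P \<xi> x t) - joint_prob P \<xi> h x t) / T x \<le> (p x - J h x) / T x"
        by (intro divide_right_mono joint_prob_bounds tail_nonneg)+
      then have "joint_prob P \<xi> h x t / T x \<le> prob (event_M P \<xi> x t) / T x"
        "prob (event_M P \<xi> x t) / T x - joint_prob P \<xi> h x t / T x \<le> p x / T x - J h x / T x"
        by (simp_all add: diff_divide_distrib)
      moreover have "4 * \<delta> + c * \<delta> < \<epsilon>" using \<delta>(2) by (simp add: distrib_right)
      ultimately have "\<bar>prob (event_M P \<xi> x t) / T x - (c - c * e)\<bar> < \<epsilon> \<and>
          \<bar>joint_prob P \<xi> h x t / T x - (c - c * e)\<bar> < \<epsilon>"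
        using px Jx q M by arith
      then show "\<bar>prob (event_M P \<xi> x t) / T x - limit_value P \<xi> F \<gamma> t\<bar> < \<epsilon> \<and>
          \<bar>1 / T x * joint_prob P \<xi> h x t - limit_value P \<xi> F \<gamma> t\<bar> < \<epsilon>"
        by (simp add: lim)
    qed
  qed
qed

end

theorem theorem2:
  fixes P :: "'a measure" and \<xi> :: "nat \<Rightarrow> 'a \<Rightarrow> real"
    and F :: "real \<Rightarrow> real" and \<gamma> :: real and h :: "real \<Rightarrow> real"
  assumes "\<gamma> > 0"
    and "distribution_function F"
    and "F \<in> class_S \<gamma>"
    and "exp_moment F \<gamma> < 1"
    and "prob_space P"
    and "prob_space.indep_vars P (\<lambda>_. borel) \<xi> {1..}"
    and "\<And>n. n \<ge> 1 \<Longrightarrow> cdf (distr P borel (\<xi> n)) = F"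
    and "\<And>x. x > 0 \<Longrightarrow> 0 < h x \<and> h x \<le> x / 2"
    and "filterlim h at_top at_top"
  shows "exp_moment_sup P \<xi> \<gamma> < \<infinity>
    \<and> (\<forall>t::real. t > 0 \<longrightarrow>
        ((\<lambda>x. 1 / tail F x * joint_prob P \<xi> h x (ereal t))
          \<longlongrightarrow> limit_value P \<xi> F \<gamma> (ereal t)) at_top \<and>
        ((\<lambda>x. measure P (event_M P \<xi> x (ereal t)) / tail F x)
          \<longlongrightarrow> limit_value P \<xi> F \<gamma> (ereal t)) at_top)
    \<and> (\<forall>t0::real. t0 > 0 \<longrightarrow>
        uniform_limit {ereal t0..\<infinity>} (\<lambda>x t. 1 / tail F x * joint_prob P \<xi> h x t)
          (limit_value P \<xi> F \<gamma>) at_top \<and>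
        uniform_limit {ereal t0..\<infinity>} (\<lambda>x t. measure P (event_M P \<xi> x t) / tail F x)
          (limit_value P \<xi> F \<gamma>) at_top)"
proof -
  interpret defective_S F \<gamma>
    using assms by unfold_locales
  interpret P: prob_space P by fact
  have "iid_walk P \<xi> \<nu>"
  proof
    fix n :: nat assume n: "n \<ge> 1"
    have "\<xi> n \<in> borel_measurable P"
      using assms(6) n by (auto simp: P.indep_vars_def)
    then show "distr P borel (\<xi> n) = \<nu>"
      using n by (intro cdf_unique nu.real_distribution_axioms) (simp_all add: cdf_nu assms(7))
  qed (rule assms(6))
  then interpret S_walk F \<gamma> P \<xi>
    by (simp add: S_walk_def defective_S_axioms)
  have h: "filterlim h at_top at_top" "\<And>x. x > 0 \<Longrightarrow> h x \<le> x / 2"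
    using assms(8,9) by auto
  have uniform:
    "uniform_limit {ereal t0..\<infinity>} (\<lambda>x t. 1 / T x * joint_prob P \<xi> h x t) (limit_value P \<xi> F \<gamma>) at_top"
    "uniform_limit {ereal t0..\<infinity>} (\<lambda>x t. measure P (event_M P \<xi> x t) / T x) (limit_value P \<xi> F \<gamma>) at_top"
    if "t0 > 0" for t0
  proof -
    have nonneg: "t \<ge> 0" if "t \<in> {ereal t0..\<infinity>}" for t
      using that \<open>t0 > 0\<close> by (auto intro: order_trans[of 0 "ereal t0"])
    have ev: "\<forall>\<^sub>F x in at_top. \<forall>t\<in>{ereal t0..\<infinity>}.
        \<bar>measure P (event_M P \<xi> x t) / T x - limit_value P \<xi> F \<gamma> t\<bar> < e \<and>
        \<bar>1 / T x * joint_prob P \<xi> h x t - limit_value P \<xi> F \<gamma> t\<bar> < e" if "e > 0" for e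
    proof -
      have "\<forall>\<^sub>F x in at_top. \<forall>t\<ge>0.
          \<bar>measure P (event_M P \<xi> x t) / T x - limit_value P \<xi> F \<gamma> t\<bar> < e \<and>
          \<bar>1 / T x * joint_prob P \<xi> h x t - limit_value P \<xi> F \<gamma> t\<bar> < e"
        by (rule uniform_limits) (use h that in auto)
      then show ?thesis by eventually_elim (use nonneg in blast)
    qed
    show "uniform_limit {ereal t0..\<infinity>} (\<lambda>x t. 1 / T x * joint_prob P \<xi> h x t) (limit_value P \<xi> F \<gamma>) at_top"
      "uniform_limit {ereal t0..\<infinity>} (\<lambda>x t. measure P (event_M P \<xi> x t) / T x) (limit_value P \<xi> F \<gamma>) at_top"
      unfolding uniform_limit_iff dist_real_def by (auto dest!: ev elim: eventually_mono)
  qed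
  show ?thesis
  proof (intro conjI allI impI)
    fix t :: real assume t: "t > 0"
    \<comment> \<open>Pointwise convergence is the uniform statement with
      \<open>t0 = t\<close>.\<close>
    show "((\<lambda>x. 1 / T x * joint_prob P \<xi> h x (ereal t)) \<longlongrightarrow> limit_value P \<xi> F \<gamma> (ereal t)) at_top"
      by (rule tendsto_uniform_limitI[OF uniform(1)[OF t]]) simp
    show "((\<lambda>x. measure P (event_M P \<xi> x (ereal t)) / T x) \<longlongrightarrow> limit_value P \<xi> F \<gamma> (ereal t)) at_top"
      by (rule tendsto_uniform_limitI[OF uniform(2)[OF t]]) simp
  qed (use exp_moment_sup_finite uniform in auto)
qed

end
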